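(* Let $\{w_t\}_{t\ge0}$ be sampled from a joint distribution $\mathcal{W}$ for which there is $m>0$ with $\mathbb{E}[w_t^\top w_{t'}]\le m$ for all $t,t'$. Then the dynamic regret of MPC with $k$ predictions over horizon $T$ satisfies $$\mathit{Reg}^S(\mathsf{MPC}_k) = \mathit{MPCS}_k^T - \mathit{STO}_T^T = O(\|F^k\|^2\, T + 1) = O(\lambda^{2k}\, T + 1),$$ for $1\le k\le T$, where the constants in $O(\cdot)$ do not depend on $k$ or $T$.
   Context: System and cost: $x_{t+1} = A x_t + B u_t + w_t$ with $x_t\in\mathbb{R}^n$, $u_t\in\mathbb{R}^d$, given $x_0$, and for horizon $T\ge1$ the cost is $J(u,w) = \sum_{t=0}^{T-1} (x_t^\top Q x_t + u_t^\top R u_t) + x_T^\top Q_f x_T$. Standing assumptions: $Q,Q_f\succeq 0$, $R\succ 0$ (symmetric); $(A,B)$ is stabilizable, i.e. there is $K_0$ with $\rho(A-BK_0)<1$ ($\rho$ = spectral radius); $(A,Q)$ is detectable, i.e. $(A^\top,Q)$ is stabilizable. $P$ is the (unique positive semidefinite) solution of $P = Q + A^\top P A - A^\top P B(R + B^\top P B)^{-1} B^\top PA$; $F=A-B(R+B^\top PB)^{-1}B^\top PA$, which satisfies $\rho(F)<1$; $\lambda=\frac{1+\rho(F)}2<1$. $\|\cdot\|$ is the spectral norm. MPC with $k\ge1$ predictions (terminal weight $P$): at each step $t$, given $x_t, w_t,\dots,w_{t+k-1}$, compute $$(u_t,\dots,u_{t+k-1})=\arg\min_{u}\ \sum_{i=t}^{t+k-1}(x_i^\top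 Qx_i+u_i^\top Ru_i)+x_{t+k}^\top P x_{t+k}\quad\text{s.t. } x_{i+1}=Ax_i+Bu_i+w_i,\ i=t,\dots,t+k-1,$$ and apply only $u_t$ (for horizon $T$, set $w_s=0$ for $s\ge T$). $J^{\mathsf{MPC}_k}(w)$ is the resulting cost $J$ for the disturbance sequence $w$, and $\mathit{MPCS}_k^T=\mathbb{E}_{w_0,\dots,w_{T-1}}J^{\mathsf{MPC}_k}(w)$. The offline optimal cost is $\mathit{STO}_T^T=\mathbb{E}_{w_0,\dots,w_{T-1}}\min_{u_0,\dots,u_{T-1}}J(u,w)$. Dynamic regret: $$\mathit{Reg}^S(\mathsf{MPC}_k)=\mathbb{E}_{(w_0,\dots,w_{T-1})\sim\mathcal{W}}\Big(J^{\mathsf{MPC}_k}(w)-\min_{u'_0,\dots,u'_{T-1}}J(u',w)\Big).$$ Notation: $f=O(g)$ means $|f|\le C\,g$ for a constant $C>0$ and all admissible values of the parameters ($k$ and $T$). *)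

theory Defs
  imports "HOL-Probability.Probability"
begin

section \<open>Matrices\<close>

definition psd :: "real^'n^'n \<Rightarrow> bool" where
  "psd M \<longleftrightarrow> transpose M = M \<and> (\<forall>x. 0 \<le> inner x (M *v x))"

definition posdef :: "real^'n^'n \<Rightarrow> bool" where
  "posdef M \<longleftrightarrow> transpose M = M \<and> (\<forall>x. x \<noteq> 0 \<longrightarrow> 0 < inner x (M *v x))"

definition complex_eigenvalues :: "real^'n^'n \<Rightarrow> complex set" where
  "complex_eigenvalues M =
     {z. \<exists>v. v \<noteq> 0 \<and> map_matrix complex_of_real M *v v = z *s v}"

definition spec_radius :: "real^'n^'n \<Rightarrow> real" where
  "spec_radius M = Max (cmod ` complex_eigenvalues M)"

text \<open>The norm of the library on matrices is the Frobenius norm; the spectral norm is the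
  operator norm with respect to the Euclidean norm.\<close>

definition spectral_norm :: "real^'n^'m \<Rightarrow> real" where
  "spectral_norm M = onorm (\<lambda>x. M *v x)"

text \<open>Multiplication and powers in the library's type classes act entrywise on matrices, so
  powers with respect to the matrix product have to be defined.\<close>

primrec mat_power :: "real^'n^'n \<Rightarrow> nat \<Rightarrow> real^'n^'n" where
  "mat_power M 0 = mat 1"
| "mat_power M (Suc k) = M ** mat_power M k"

definition stabilizable :: "real^'n^'n \<Rightarrow> real^'d^'n \<Rightarrow> bool" where
  "stabilizable A B \<longleftrightarrow> (\<exists>K. spec_radius (A - B ** K) < 1)"

definition detectable :: "real^'n^'n \<Rightarrow> real^'n^'m \<Rightarrow> bool" where
  "detectable A C \<longleftrightarrow> stabilizable (transpose A) (transpose C)"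

section \<open>The Riccati equation\<close>

definition lqr_gain ::
  "real^'n^'n \<Rightarrow> real^'d^'n \<Rightarrow> real^'d^'d \<Rightarrow> real^'n^'n \<Rightarrow> real^'n^'d" where
  "lqr_gain A B R P =
     matrix_inv (R + transpose B ** P ** B) ** transpose B ** P ** A"

definition riccati_solution ::
  "real^'n^'n \<Rightarrow> real^'d^'n \<Rightarrow> real^'n^'n \<Rightarrow> real^'d^'d \<Rightarrow> real^'n^'n \<Rightarrow> bool" where
  "riccati_solution A B Q R P \<longleftrightarrow>
     P = Q + transpose A ** P ** A
         - transpose A ** P ** B ** matrix_inv (R + transpose B ** P ** B)
             ** transpose B ** P ** A"

definition closed_loop ::
  "real^'n^'n \<Rightarrow> real^'d^'n \<Rightarrow> real^'d^'d \<Rightarrow> real^'n^'n \<Rightarrow> real^'n^'n" where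
  "closed_loop A B R P = A - B ** lqr_gain A B R P"

section \<open>Dynamics and costs\<close>

primrec state :: "real^'n^'n \<Rightarrow> real^'d^'n \<Rightarrow> real^'n \<Rightarrow> (nat \<Rightarrow> real^'n) \<Rightarrow> (nat \<Rightarrow> real^'d)
    \<Rightarrow> nat \<Rightarrow> real^'n" where
  "state A B x0 w u 0 = x0"
| "state A B x0 w u (Suc t) = A *v state A B x0 w u t + B *v u t + w t"

text \<open>Disturbances and controls are infinite sequences, but the cost over horizon \<open>N\<close>
  only depends on their entries at times \<open>0, ..., N - 1\<close>. The argument \<open>S\<close> is the
  terminal weight.\<close>

definition cost :: "real^'n^'n \<Rightarrow> real^'d^'n \<Rightarrow> real^'n^'n \<Rightarrow> real^'d^'d \<Rightarrow> real^'n^'n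
    \<Rightarrow> real^'n \<Rightarrow> nat \<Rightarrow> (nat \<Rightarrow> real^'n) \<Rightarrow> (nat \<Rightarrow> real^'d) \<Rightarrow> real" where
  "cost A B Q R S x0 N w u =
     (\<Sum>t<N. inner (state A B x0 w u t) (Q *v state A B x0 w u t) + inner (u t) (R *v u t))
     + inner (state A B x0 w u N) (S *v state A B x0 w u N)"

text \<open>The offline optimal cost. The minimum of the cost, a convex quadratic function that is
  bounded below by 0, is attained and hence equals the infimum.\<close>

definition opt_cost :: "real^'n^'n \<Rightarrow> real^'d^'n \<Rightarrow> real^'n^'n \<Rightarrow> real^'d^'d \<Rightarrow> real^'n^'n
    \<Rightarrow> real^'n \<Rightarrow> nat \<Rightarrow> (nat \<Rightarrow> real^'n) \<Rightarrow> real" where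
  "opt_cost A B Q R Qf x0 T w = (INF u. cost A B Q R Qf x0 T w u)"

section \<open>Model predictive control\<close>

text \<open>The problem solved at time \<open>t\<close> is written in the time shifted to start at 0: \<open>x\<close> is the
  current state, \<open>v i\<close> is the prediction of the disturbance at time \<open>t + i\<close>, and entry \<open>i\<close> of
  the plan is the control planned for time \<open>t + i\<close>. The entries of the minimizer with indices
  below \<open>k\<close> are unique since \<open>R\<close> is positive definite; the others are irrelevant, and
  only entry 0 is applied.\<close>

definition mpc_plan :: "real^'n^'n \<Rightarrow> real^'d^'n \<Rightarrow> real^'n^'n \<Rightarrow> real^'d^'d \<Rightarrow> real^'n^'n
    \<Rightarrow> nat \<Rightarrow> real^'n \<Rightarrow> (nat \<Rightarrow> real^'n) \<Rightarrow> (nat \<Rightarrow> real^'d)" where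
  "mpc_plan A B Q R P k x v = arg_min (cost A B Q R P x k v) (\<lambda>u. True)"

definition mpc_action :: "real^'n^'n \<Rightarrow> real^'d^'n \<Rightarrow> real^'n^'n \<Rightarrow> real^'d^'d \<Rightarrow> real^'n^'n
    \<Rightarrow> nat \<Rightarrow> real^'n \<Rightarrow> (nat \<Rightarrow> real^'n) \<Rightarrow> real^'d" where
  "mpc_action A B Q R P k x v = mpc_plan A B Q R P k x v 0"

primrec mpc_state :: "real^'n^'n \<Rightarrow> real^'d^'n \<Rightarrow> real^'n^'n \<Rightarrow> real^'d^'d \<Rightarrow> real^'n^'n
    \<Rightarrow> nat \<Rightarrow> real^'n \<Rightarrow> (nat \<Rightarrow> real^'n) \<Rightarrow> nat \<Rightarrow> real^'n" where
  "mpc_state A B Q R P k x0 w 0 = x0"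
| "mpc_state A B Q R P k x0 w (Suc t) =
     A *v mpc_state A B Q R P k x0 w t
     + B *v mpc_action A B Q R P k (mpc_state A B Q R P k x0 w t) (\<lambda>i. w (t + i))
     + w t"

definition mpc_input :: "real^'n^'n \<Rightarrow> real^'d^'n \<Rightarrow> real^'n^'n \<Rightarrow> real^'d^'d \<Rightarrow> real^'n^'n
    \<Rightarrow> nat \<Rightarrow> real^'n \<Rightarrow> (nat \<Rightarrow> real^'n) \<Rightarrow> nat \<Rightarrow> real^'d" where
  "mpc_input A B Q R P k x0 w t =
     mpc_action A B Q R P k (mpc_state A B Q R P k x0 w t) (\<lambda>i. w (t + i))"

definition cut_off :: "nat \<Rightarrow> (nat \<Rightarrow> real^'n) \<Rightarrow> nat \<Rightarrow> real^'n" where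
  "cut_off T w s = (if s < T then w s else 0)"

definition mpc_cost :: "real^'n^'n \<Rightarrow> real^'d^'n \<Rightarrow> real^'n^'n \<Rightarrow> real^'d^'d \<Rightarrow> real^'n^'n
    \<Rightarrow> real^'n^'n \<Rightarrow> real^'n \<Rightarrow> nat \<Rightarrow> nat \<Rightarrow> (nat \<Rightarrow> real^'n) \<Rightarrow> real" where
  "mpc_cost A B Q R Qf P x0 k T w =
     cost A B Q R Qf x0 T w (mpc_input A B Q R P k x0 (cut_off T w))"

section \<open>Expected costs and dynamic regret\<close>

text \<open>\<open>W\<close> is the joint distribution of the disturbance sequence.\<close>

definition MPCS :: "real^'n^'n \<Rightarrow> real^'d^'n \<Rightarrow> real^'n^'n \<Rightarrow> real^'d^'d \<Rightarrow> real^'n^'n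
    \<Rightarrow> real^'n^'n \<Rightarrow> real^'n \<Rightarrow> (nat \<Rightarrow> real^'n) measure \<Rightarrow> nat \<Rightarrow> nat \<Rightarrow> real" where
  "MPCS A B Q R Qf P x0 W k T = (\<integral>w. mpc_cost A B Q R Qf P x0 k T w \<partial>W)"

definition STO :: "real^'n^'n \<Rightarrow> real^'d^'n \<Rightarrow> real^'n^'n \<Rightarrow> real^'d^'d \<Rightarrow> real^'n^'n
    \<Rightarrow> real^'n \<Rightarrow> (nat \<Rightarrow> real^'n) measure \<Rightarrow> nat \<Rightarrow> real" where
  "STO A B Q R Qf x0 W T = (\<integral>w. opt_cost A B Q R Qf x0 T w \<partial>W)"

definition mpc_regret :: "real^'n^'n \<Rightarrow> real^'d^'n \<Rightarrow> real^'n^'n \<Rightarrow> real^'d^'d \<Rightarrow> real^'n^'n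
    \<Rightarrow> real^'n^'n \<Rightarrow> real^'n \<Rightarrow> (nat \<Rightarrow> real^'n) measure \<Rightarrow> nat \<Rightarrow> nat \<Rightarrow> real" where
  "mpc_regret A B Q R Qf P x0 W k T =
     (\<integral>w. (mpc_cost A B Q R Qf P x0 k T w - opt_cost A B Q R Qf x0 T w) \<partial>W)"

end

(* The cost with terminal weight P equals a constant plus a sum of e_t . H e_t, where
   H = R + B^T P B and e_t is the deviation of the control from the optimal affine feedback, which
   uses the costate psi_t, the sum of (F^T)^i P w_(t+i) over i < T - t. MPC with k predictions
   applies the same feedback with the sum truncated to i < k, so it deviates by
   H^-1 B^T (F^T)^k psi_(t+k). This gives the term |F^k|^2 T.

   For another terminal weight Qf it remains to compare the two optimal costs. Detectability
   bounds the terminal state of any trajectory started at 0 by its stage costs alone, uniformly in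
   T; completing a square in this terminal state shows that no control beats the optimal cost for P
   by more than a multiple of the squared terminal state of the trajectory optimal for P. This and
   the terminal state under MPC are bounded in mean square because F is exponentially stable. *)

theory Submission
  imports Defs "HOL-Computational_Algebra.Fundamental_Theorem_Algebra"
begin

section \<open>Powers of matrices and the spectral radius\<close>

text \<open>\<open>Qf\<close> need not dominate \<open>P\<close>, so a control may save terminal
  cost against the one that is optimal for \<open>P\<close>. The saving has no bound by itself and
  has to be paid for by stage costs; detectability is what keeps a terminal state from growing free
  of charge. The constants must not depend on \<open>k\<close> or \<open>T\<close>. All states and
  costates are convolutions with powers of a stable matrix, and Cauchy-Schwarz with geometric
  weights reduces their mean squares to second moments of single disturbances, whatever the
  correlations between them. Powers of \<open>F\<close> decay at every rate above the spectral
  radius, but in general not at that rate itself, since nontrivial Jordan blocks add polynomial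
  factors; \<open>lam\<close> leaves the room for this. An annihilating polynomial, split into
  linear factors, takes the place of the Jordan form.\<close>

definition poly_apply :: "complex^'n^'n \<Rightarrow> complex poly \<Rightarrow> complex^'n \<Rightarrow> complex^'n" where
  "poly_apply T p v = fold_coeffs (\<lambda>a y. a *s v + T *v y) p 0"

lemma poly_apply_0 [simp]: "poly_apply T 0 v = 0"
  by (simp add: poly_apply_def)

lemma poly_apply_pCons [simp]: "poly_apply T (pCons a p) v = a *s v + T *v poly_apply T p v"
  by (cases "a = 0 \<and> p = 0") (auto simp: poly_apply_def)

lemma poly_apply_add: "poly_apply T (p + q) v = poly_apply T p v + poly_apply T q v"
proof (induction p arbitrary: q)
  case (pCons a p)
  then show ?case
    by (cases q) (auto simp: matrix_vector_right_distrib vec.scale_left_distrib algebra_simps)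
qed simp

lemma poly_apply_smult: "poly_apply T (smult c p) v = c *s poly_apply T p v"
  by (induction p)
    (auto simp: vec.scale_right_distrib vector_scalar_commute)

lemma poly_apply_mult: "poly_apply T (p * q) v = poly_apply T p (poly_apply T q v)"
  by (induction p) (auto simp: poly_apply_add poly_apply_smult)

lemma poly_apply_sum: "poly_apply T (\<Sum>i\<in>I. p i) v = (\<Sum>i\<in>I. poly_apply T (p i) v)"
  by (induction I rule: infinite_finite_induct) (auto simp: poly_apply_add)

lemma poly_apply_monom: "poly_apply T (monom c i) v = c *s (((*v) T ^^ i) v)"
  by (induction i) (auto simp: monom_0 monom_Suc vector_scalar_commute)

lemma poly_apply_eigenvector:
  assumes "T *v v = z *s v"
  shows "poly_apply T p v = poly p z *s v"
  by (induction p) (auto simp: assms vector_scalar_commute vec.scale_scale vec.scale_left_distrib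
    algebra_simps)

text \<open>Dependence of an indexed family rather than of a set: powers of a matrix may repeat, and
  a repetition \<open>X i = X j\<close> is already a relation.\<close>

lemma nontrivial_combination:
  fixes X :: "nat \<Rightarrow> 'a::euclidean_space"
  obtains c where "\<exists>i\<le>DIM('a). c i \<noteq> 0" "(\<Sum>i\<le>DIM('a). c i *\<^sub>R X i) = 0"
proof (cases "inj_on X {..DIM('a)}")
  case True
  then have "card (X ` {..DIM('a)}) > DIM('a)"
    by (simp add: card_image)
  then have "dependent (X ` {..DIM('a)})"
    by (intro dependent_biggerset) auto
  then obtain u where u: "\<exists>v\<in>X ` {..DIM('a)}. u v \<noteq> 0"
      "(\<Sum>v\<in>X ` {..DIM('a)}. u v *\<^sub>R v) = 0"
    by (auto simp: dependent_finite)
  show ?thesis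
    using u True by (intro that[of "u \<circ> X"]) (auto simp: sum.reindex)
next
  case False
  then obtain i j where ij: "i \<le> DIM('a)" "j \<le> DIM('a)" "i \<noteq> j" "X i = X j"
    by (auto simp: inj_on_def)
  define c :: "nat \<Rightarrow> real" where "c l = (if l = i then 1 else if l = j then - 1 else 0)" for l
  have "(\<Sum>l\<le>DIM('a). c l *\<^sub>R X l) = (\<Sum>l\<in>{i,j}. c l *\<^sub>R X l)"
    by (rule sum.mono_neutral_right) (use ij in \<open>auto simp: c_def\<close>)
  then show ?thesis
    using ij by (intro that[of c]) (auto simp: c_def)
qed

text \<open>More powers of \<open>T\<close> than the real dimension of the matrix space are linearly
  dependent. This weak form of Cayley-Hamilton suffices because the degree of \<open>p\<close> never
  matters.\<close>

lemma annihilating_polynomial: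
  fixes T :: "complex^'n^'n"
  obtains p where "p \<noteq> 0" "\<And>v. poly_apply T p v = 0"
proof -
  define X where "X i = (((**) T) ^^ i) (mat 1)" for i
  have X: "X i *v v = ((*v) T ^^ i) v" for i v
    by (induction i) (auto simp: X_def matrix_vector_mul_assoc[symmetric])
  define N where "N = DIM(complex^'n^'n)"
  obtain c where c: "\<exists>i\<le>N. c i \<noteq> 0" "(\<Sum>i\<le>N. c i *\<^sub>R X i) = 0"
    using nontrivial_combination[of X] unfolding N_def by blast
  define p where "p = (\<Sum>i\<le>N. monom (complex_of_real (c i)) i)"
  have "coeff p i = complex_of_real (c i)" if "i \<le> N" for i
    using that by (simp add: p_def coeff_sum)
  then have "p \<noteq> 0"
    using c(1) by (metis coeff_0 of_real_eq_0_iff)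
  moreover have "poly_apply T p v = 0" for v
  proof -
    have *: "complex_of_real a *s y = a *\<^sub>R y" for a and y :: "complex^'n"
      by (simp add: vec_eq_iff scaleR_conv_of_real[symmetric])
    have **: "(a *\<^sub>R Y) *v v = a *\<^sub>R (Y *v v)" for a and Y :: "complex^'n^'n"
      by (simp add: vec_eq_iff matrix_vector_mult_def scaleR_sum_right)
    have ***: "sum Y I *v v = (\<Sum>i\<in>I. Y i *v v)" for Y :: "nat \<Rightarrow> complex^'n^'n" and I
      by (induction I rule: infinite_finite_induct) (auto simp: matrix_vector_mult_add_rdistrib)
    have "poly_apply T p v = (\<Sum>i\<le>N. c i *\<^sub>R X i) *v v"
      by (simp add: p_def poly_apply_sum poly_apply_monom X * ** ***)
    then show ?thesis
      using c(2) by simp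
  qed
  ultimately show ?thesis
    using that by blast
qed

lemma linear_factor:
  fixes p :: "complex poly"
  assumes "degree p > 0"
  obtains z q where "p = [:-z, 1:] * q" "degree q < degree p" "q \<noteq> 0"
proof -
  have "\<not> constant (poly p)"
    using assms by (simp add: constant_degree)
  then obtain z where "poly p z = 0"
    using fundamental_theorem_of_algebra by blast
  then obtain q where q: "p = [:-z, 1:] * q"
    by (auto simp: poly_eq_0_iff_dvd dvd_def)
  with assms have "q \<noteq> 0"
    by auto
  then have "degree p = Suc (degree q)"
    by (simp only: q) (subst degree_mult_eq, auto)
  with q \<open>q \<noteq> 0\<close> show ?thesis
    using that by auto
qed

lemma poly_apply_linear: "poly_apply T [:-z, 1:] v = T *v v - z *s v"
  by (simp add: vec_eq_iff)

text \<open>Linear factors are peeled off: for \<open>p = (X - z) q\<close> either \<open>q\<close>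
  already annihilates \<open>v\<close>, and the degree drops, or \<open>q\<close> applied to
  \<open>v\<close> is an eigenvector for \<open>z\<close>.\<close>

lemma annihilated_imp_eigenvalue:
  fixes T :: "complex^'n^'n"
  assumes "p \<noteq> 0" "poly_apply T p v = 0" "v \<noteq> 0"
  shows "\<exists>z y. y \<noteq> 0 \<and> T *v y = z *s y"
  using assms
proof (induction "degree p" arbitrary: p rule: less_induct)
  case less
  show ?case
  proof (cases "degree p = 0")
    case True
    then obtain a where "p = [:a:]" by (metis degree_eq_zeroE)
    with less.prems show ?thesis by (auto simp: vec_eq_iff)
  next
    case False
    then obtain z q where q: "p = [:-z, 1:] * q" "degree q < degree p" "q \<noteq> 0"
      using linear_factor by blast
    let ?y = "poly_apply T q v"
    show ?thesis
    proof (cases "?y = 0")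
      case True
      then show ?thesis using less.hyps[OF q(2,3)] less.prems(3) by blast
    next
      case False
      have "poly_apply T [:-z, 1:] ?y = 0"
        using less.prems(2) by (simp only: q(1) poly_apply_mult)
      then have "T *v ?y = z *s ?y"
        by (simp only: poly_apply_linear right_minus_eq)
      with False show ?thesis by blast
    qed
  qed
qed

text \<open>Together with finiteness this makes the \<open>Max\<close> in \<open>spec_radius\<close>
  meaningful.\<close>

lemma eigenvalue_exists: "complex_eigenvalues M \<noteq> {}"
proof -
  obtain p where "p \<noteq> 0" "\<And>v. poly_apply (map_matrix complex_of_real M) p v = 0"
    using annihilating_polynomial by blast
  moreover have "(axis undefined 1 :: complex^'n) \<noteq> 0"
    by simp
  ultimately show ?thesis
    using annihilated_imp_eigenvalue unfolding complex_eigenvalues_def by blast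
qed

lemma finite_complex_eigenvalues: "finite (complex_eigenvalues M)"
proof -
  let ?T = "map_matrix complex_of_real M"
  obtain p where p: "p \<noteq> 0" "\<And>v. poly_apply ?T p v = 0"
    using annihilating_polynomial by blast
  have "complex_eigenvalues M \<subseteq> {z. poly p z = 0}"
  proof
    fix z assume "z \<in> complex_eigenvalues M"
    then obtain v where "v \<noteq> 0" "?T *v v = z *s v"
      by (auto simp: complex_eigenvalues_def)
    then have "poly p z *s v = 0"
      using p(2)[of v] poly_apply_eigenvector by metis
    then show "z \<in> {z. poly p z = 0}"
      using \<open>v \<noteq> 0\<close> by (auto simp: vec_eq_iff)
  qed
  then show ?thesis
    using poly_roots_finite[OF p(1)] finite_subset by blast
qed

lemma eigenvalue_le_spec_radius: "z \<in> complex_eigenvalues M \<Longrightarrow> cmod z \<le> spec_radius M"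
  unfolding spec_radius_def by (intro Max_ge) (auto simp: finite_complex_eigenvalues)

lemma spec_radius_less_iff: "spec_radius M < r \<longleftrightarrow> (\<forall>z\<in>complex_eigenvalues M. cmod z < r)"
  unfolding spec_radius_def by (subst Max_less_iff) (auto simp: finite_complex_eigenvalues eigenvalue_exists)

lemma spec_radius_nonneg: "spec_radius M \<ge> 0"
  using eigenvalue_exists eigenvalue_le_spec_radius norm_ge_zero order_trans by blast

text \<open>An eigenvalue factor \<open>T - z\<close> costs one step of the scalar recursion
  \<open>a (k + 1) \<le> \<bar>z\<bar> a k + C r ^ k\<close>; any other factor is injective and can be dropped.\<close>

lemma annihilated_imp_decay:
  fixes T :: "complex^'n^'n"
  assumes "p \<noteq> 0" "poly_apply T p v = 0"
    and r: "\<And>z y. y \<noteq> 0 \<Longrightarrow> T *v y = z *s y \<Longrightarrow> cmod z < r" and "r > 0"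
  shows "\<exists>C. \<forall>k. norm (((*v) T ^^ k) v) \<le> C * r ^ k"
  using assms(1,2)
proof (induction "degree p" arbitrary: p v rule: less_induct)
  case less
  show ?case
  proof (cases "degree p = 0")
    case True
    then obtain a where "p = [:a:]" by (metis degree_eq_zeroE)
    with less.prems have "v = 0" by (auto simp: vec_eq_iff)
    have "((*v) T ^^ k) (0::complex^'n) = 0" for k
      by (induction k) auto
    with \<open>v = 0\<close> show ?thesis by (intro exI[of _ 0]) auto
  next
    case False
    then obtain z q where q: "p = [:-z, 1:] * q" "degree q < degree p" "q \<noteq> 0"
      using linear_factor by blast
    let ?y = "poly_apply T q v"
    show ?thesis
    proof (cases "?y = 0")
      case True
      then show ?thesis using less.hyps[OF q(2,3)] by blast
    next
      case False
      have "poly_apply T [:-z, 1:] ?y = 0"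
        using less.prems(2) by (simp only: q(1) poly_apply_mult)
      then have "T *v ?y = z *s ?y"
        by (simp only: poly_apply_linear right_minus_eq)
      with False have z: "cmod z < r"
        using r by blast
      \<comment> \<open>The factors of \<open>p\<close> commute, so \<open>q\<close> annihilates
        \<open>(T - z) v\<close> and the induction hypothesis applies to this vector.\<close>
      define d where "d = T *v v - z *s v"
      have "poly_apply T q d = 0"
        using less.prems(2) by (simp only: q(1) poly_apply_mult mult.commute[of _ q] d_def poly_apply_linear)
      then obtain C where C: "\<And>k. norm (((*v) T ^^ k) d) \<le> C * r ^ k"
        using less.hyps[OF q(2,3)] by blast
      have "C \<ge> 0"
        using C[of 0] norm_ge_zero[of d] by (simp del: norm_ge_zero)
      \<comment> \<open>Solves \<open>cmod z * C' + C \<le> r * C'\<close>, which closes the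
        induction on \<open>k\<close>; the summand \<open>norm v\<close> covers
        \<open>k = 0\<close>.\<close>
      define C' where "C' = norm v + C / (r - cmod z)"
      have C': "cmod z * C' + C \<le> r * C'"
      proof -
        have "(r - cmod z) * C' = (r - cmod z) * norm v + C"
          using z by (simp add: C'_def field_simps)
        moreover have "(r - cmod z) * norm v \<ge> 0"
          using z by simp
        ultimately show ?thesis by (simp add: algebra_simps)
      qed
      have step: "((*v) T ^^ Suc k) v = z *s ((*v) T ^^ k) v + ((*v) T ^^ k) d" for k
      proof (induction k)
        case (Suc k)
        have "((*v) T ^^ Suc (Suc k)) v = T *v (((*v) T ^^ Suc k) v)" by simp
        also have "\<dots> = z *s ((*v) T ^^ Suc k) v + ((*v) T ^^ Suc k) d"
          by (subst Suc) (simp add: matrix_vector_right_distrib vector_scalar_commute)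
        finally show ?case .
      qed (simp add: d_def)
      have "norm (((*v) T ^^ k) v) \<le> C' * r ^ k" for k
      proof (induction k)
        case 0
        then show ?case using \<open>C \<ge> 0\<close> z by (simp add: C'_def)
      next
        case (Suc k)
        have ns: "norm (c *s y) = cmod c * norm y" for c and y :: "complex^'n"
          by (simp add: norm_vec_def norm_mult L2_set_right_distrib)
        have "norm (((*v) T ^^ Suc k) v) \<le> cmod z * norm (((*v) T ^^ k) v) + norm (((*v) T ^^ k) d)"
          unfolding step using norm_triangle_ineq ns by metis
        also have "\<dots> \<le> cmod z * (C' * r ^ k) + C * r ^ k"
          by (intro add_mono mult_left_mono Suc C) auto
        also have "\<dots> = (cmod z * C' + C) * r ^ k"
          by (simp add: algebra_simps)
        also have "\<dots> \<le> (r * C') * r ^ k"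
          using C' \<open>r > 0\<close> by (intro mult_right_mono) auto
        finally show ?case by (simp add: algebra_simps)
      qed
      then show ?thesis by blast
    qed
  qed
qed

text \<open>Complexification preserves the Euclidean norm, so decay of complex orbits carries over
  to real ones. The constant of an orbit depends on its starting vector; summing over the finitely
  many basis vectors makes it uniform.\<close>

lemma power_decay:
  fixes M :: "real^'n^'n"
  assumes "spec_radius M < r"
  obtains C where "C > 0" "\<And>k x. norm (mat_power M k *v x) \<le> C * r ^ k * norm x"
proof -
  let ?T = "map_matrix complex_of_real M"
  let ?c = "\<lambda>x::real^'n. (\<chi> i. complex_of_real (x $ i))"
  have "r > 0"
    using assms spec_radius_nonneg[of M] by linarith
  obtain p where p: "p \<noteq> 0" "\<And>v. poly_apply ?T p v = 0"
    using annihilating_polynomial by blast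
  have "\<exists>C. \<forall>k. norm (((*v) ?T ^^ k) v) \<le> C * r ^ k" for v
    using p assms \<open>r > 0\<close>
    by (intro annihilated_imp_decay[of p]) (auto simp: spec_radius_less_iff complex_eigenvalues_def)
  then obtain C where C: "\<And>v k. norm (((*v) ?T ^^ k) v) \<le> C v * r ^ k"
    by metis
  have Tc: "?T *v ?c x = ?c (M *v x)" for x
    by (simp add: vec_eq_iff matrix_vector_mult_def map_matrix_def)
  have "((*v) ?T ^^ k) (?c x) = ?c (mat_power M k *v x)" for k x
    by (induction k) (simp_all add: Tc matrix_vector_mul_assoc)
  moreover have "norm (?c x) = norm x" for x
    by (simp add: norm_vec_def)
  ultimately have bound: "norm (mat_power M k *v x) \<le> C (?c x) * r ^ k" for k x
    using C[of k "?c x"] by simp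
  define D where "D = (\<Sum>j\<in>UNIV. \<bar>C (?c (axis j 1))\<bar>)"
  have "norm (mat_power M k *v x) \<le> (D + 1) * r ^ k * norm x" for k x
  proof -
    have "mat_power M k *v x = mat_power M k *v (\<Sum>j\<in>UNIV. x $ j *\<^sub>R axis j 1)"
      by (simp add: basis_expansion[of x, unfolded scalar_mult_eq_scaleR])
    also have "\<dots> = (\<Sum>j\<in>UNIV. x $ j *\<^sub>R (mat_power M k *v axis j 1))"
      by (simp add: linear_sum[OF matrix_vector_mul_linear] linear_cmul[OF matrix_vector_mul_linear])
    also have "norm \<dots> \<le> (\<Sum>j\<in>UNIV. norm x * (\<bar>C (?c (axis j 1))\<bar> * r ^ k))"
    proof (intro order_trans[OF norm_sum] sum_mono)
      fix j
      have "norm (mat_power M k *v axis j 1) \<le> C (?c (axis j 1)) * r ^ k"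
        by (rule bound)
      also have "\<dots> \<le> \<bar>C (?c (axis j 1))\<bar> * r ^ k"
        using \<open>r > 0\<close> by (intro mult_right_mono) auto
      finally show "norm (x $ j *\<^sub>R (mat_power M k *v axis j 1)) \<le> norm x * (\<bar>C (?c (axis j 1))\<bar> * r ^ k)"
        using component_le_norm_cart[of x j] by (auto intro!: mult_mono)
    qed
    also have "\<dots> = D * r ^ k * norm x"
      by (simp add: D_def sum_distrib_left sum_distrib_right mult_ac)
    also have "\<dots> \<le> (D + 1) * r ^ k * norm x"
      using \<open>r > 0\<close> by (intro mult_right_mono) auto
    finally show ?thesis .
  qed
  moreover have "D + 1 > 0"
    unfolding D_def by (smt (verit) sum_nonneg abs_ge_zero)
  ultimately show ?thesis
    using that by blast
qed

section \<open>The spectral norm and exponential stability\<close>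

declare transpose_matrix_vector [simp del]

lemma inner_matrix_transpose: "inner x (M *v y) = inner (transpose M *v x) y"
  for M :: "real^'n^'m"
  by (simp add: transpose_matrix_vector dot_lmul_matrix)

lemma inner_transpose_matrix: "inner x (transpose M *v y) = inner (M *v x) y"
  for M :: "real^'n^'m"
  by (simp add: inner_matrix_transpose transpose_transpose)

lemma norm_matrix_le: "norm (M *v x) \<le> spectral_norm M * norm x"
  unfolding spectral_norm_def by (rule onorm) (rule matrix_vector_mul_bounded_linear)

lemma spectral_norm_nonneg: "0 \<le> spectral_norm M"
  unfolding spectral_norm_def by (rule onorm_pos_le) (rule matrix_vector_mul_bounded_linear)

lemma inner_matrix_le: "\<bar>inner x (M *v y)\<bar> \<le> spectral_norm M * norm x * norm y"
proof -
  have "\<bar>inner x (M *v y)\<bar> \<le> norm x * norm (M *v y)"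
    by (rule Cauchy_Schwarz_ineq2)
  also have "\<dots> \<le> norm x * (spectral_norm M * norm y)"
    by (intro mult_left_mono norm_matrix_le) auto
  finally show ?thesis by (simp add: mult_ac)
qed

lemma inner_matrix_le_square: "\<bar>inner x (M *v x)\<bar> \<le> spectral_norm M * (norm x)\<^sup>2"
  using inner_matrix_le[of x M x] by (simp add: power2_eq_square mult.assoc)

lemma spectral_norm_transpose_le: "spectral_norm (transpose M) \<le> spectral_norm M"
  for M :: "real^'n^'m"
proof -
  have "norm (transpose M *v x) \<le> spectral_norm M * norm x" for x
  proof -
    let ?y = "transpose M *v x"
    have "norm ?y * norm ?y = inner x (M *v ?y)"
      by (simp add: inner_matrix_transpose dot_square_norm power2_eq_square)
    also have "\<dots> \<le> (spectral_norm M * norm x) * norm ?y"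
      using inner_matrix_le[of x M ?y] by linarith
    finally show ?thesis
      using spectral_norm_nonneg[of M]
      by (cases "?y = 0") (auto simp: mult_nonneg_nonneg dest: mult_right_le_imp_le)
  qed
  then show ?thesis
    unfolding spectral_norm_def by (intro onorm_le) auto
qed

lemma spectral_norm_transpose: "spectral_norm (transpose M) = spectral_norm M"
  using spectral_norm_transpose_le[of M] spectral_norm_transpose_le[of "transpose M"]
  by (simp add: transpose_transpose)

lemma mat_power_add: "mat_power M (i + j) = mat_power M i ** mat_power M j"
  by (induction i) (simp_all add: matrix_mul_assoc)

lemma mat_power_commute: "mat_power M k ** M = M ** mat_power M k"
  by (induction k) (simp_all add: matrix_mul_assoc[symmetric])

lemma transpose_mat_power: "transpose (mat_power M k) = mat_power (transpose M) k"
  by (induction k) (simp_all add: transpose_mat matrix_transpose_mul mat_power_commute)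

definition exp_stable :: "real^'n^'n \<Rightarrow> real \<Rightarrow> real \<Rightarrow> bool" where
  "exp_stable M C r \<longleftrightarrow> C > 0 \<and> 0 < r \<and> r < 1 \<and> (\<forall>k. spectral_norm (mat_power M k) \<le> C * r ^ k)"

lemma exp_stable_transpose: "exp_stable (transpose M) C r = exp_stable M C r"
  by (simp add: exp_stable_def flip: transpose_mat_power) (simp add: spectral_norm_transpose)

lemma spec_radius_imp_exp_stable:
  assumes "spec_radius M < r" "r < 1"
  obtains C where "exp_stable M C r"
proof -
  obtain C where C: "C > 0" "\<And>k x. norm (mat_power M k *v x) \<le> C * r ^ k * norm x"
    using power_decay[OF assms(1)] by blast
  then have "spectral_norm (mat_power M k) \<le> C * r ^ k" for k
    unfolding spectral_norm_def by (intro onorm_le) auto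
  with C show ?thesis
    using assms spec_radius_nonneg[of M] by (intro that[of C]) (auto simp: exp_stable_def)
qed

lemma sum_lessThan_add: "(\<Sum>i<k + m. f i) = (\<Sum>i<k. f i) + (\<Sum>i<m. f (k + i))"
  for f :: "nat \<Rightarrow> 'b::comm_monoid_add"
  by (induction m) (simp_all add: add.assoc)

lemma weighted_Cauchy_Schwarz:
  fixes a b :: "'i \<Rightarrow> real"
  assumes "\<And>i. i \<in> I \<Longrightarrow> a i \<ge> 0"
  shows "(\<Sum>i\<in>I. a i * b i)\<^sup>2 \<le> (\<Sum>i\<in>I. a i) * (\<Sum>i\<in>I. a i * (b i)\<^sup>2)"
proof -
  have "(\<Sum>i\<in>I. a i * b i)\<^sup>2 = (\<Sum>i\<in>I. sqrt (a i) * (sqrt (a i) * b i))\<^sup>2"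
    using assms by (simp add: mult.assoc[symmetric])
  also have "\<dots> \<le> (\<Sum>i\<in>I. (sqrt (a i))\<^sup>2) * (\<Sum>i\<in>I. (sqrt (a i) * b i)\<^sup>2)"
    by (rule Cauchy_Schwarz_ineq_sum)
  also have "\<dots> = (\<Sum>i\<in>I. a i) * (\<Sum>i\<in>I. a i * (b i)\<^sup>2)"
    using assms by (simp add: power_mult_distrib)
  finally show ?thesis .
qed

lemma geometric_sum_le: "(\<Sum>i<n. r ^ i) \<le> 1 / (1 - r)" if "0 < r" "r < 1" for r :: real
  using that by (subst sum_gp_strict) (auto simp: divide_simps)

text \<open>Cauchy-Schwarz with the weights \<open>r ^ i\<close> makes the constant independent of
  \<open>n\<close>. The weights stay in the sum so that they can later be summed against
  expectations or simply be bounded by 1.\<close>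

lemma exp_stable_convolution:
  assumes "exp_stable M C r"
  shows "(norm (\<Sum>i<n. mat_power M i *v d i))\<^sup>2 \<le> C\<^sup>2 / (1 - r) * (\<Sum>i<n. r ^ i * (norm (d i))\<^sup>2)"
proof -
  have C: "C > 0" "0 < r" "r < 1" "\<And>k. spectral_norm (mat_power M k) \<le> C * r ^ k"
    using assms by (auto simp: exp_stable_def)
  have "norm (\<Sum>i<n. mat_power M i *v d i) \<le> (\<Sum>i<n. C * r ^ i * norm (d i))"
    by (intro order_trans[OF norm_sum] sum_mono order_trans[OF norm_matrix_le] mult_right_mono C) auto
  also have "\<dots> = C * (\<Sum>i<n. r ^ i * norm (d i))"
    by (simp add: sum_distrib_left mult_ac)
  finally have "(norm (\<Sum>i<n. mat_power M i *v d i))\<^sup>2 \<le> C\<^sup>2 * (\<Sum>i<n. r ^ i * norm (d i))\<^sup>2"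
    by (rule order_trans[OF power_mono]) (simp_all add: power_mult_distrib)
  also have "\<dots> \<le> C\<^sup>2 * ((\<Sum>i<n. r ^ i) * (\<Sum>i<n. r ^ i * (norm (d i))\<^sup>2))"
    using C by (intro mult_left_mono weighted_Cauchy_Schwarz) auto
  also have "\<dots> \<le> C\<^sup>2 * (1 / (1 - r) * (\<Sum>i<n. r ^ i * (norm (d i))\<^sup>2))"
    using C by (intro mult_left_mono mult_right_mono geometric_sum_le sum_nonneg) auto
  finally show ?thesis by simp
qed

primrec affine_orbit :: "real^'n^'n \<Rightarrow> real^'n \<Rightarrow> (nat \<Rightarrow> real^'n) \<Rightarrow> nat \<Rightarrow> real^'n" where
  "affine_orbit M x0 d 0 = x0"
| "affine_orbit M x0 d (Suc t) = M *v affine_orbit M x0 d t + d t"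

lemma matrix_vector_sum: "M *v (\<Sum>i\<in>I. f i) = (\<Sum>i\<in>I. M *v f i)" for M :: "real^'n^'m"
  by (rule linear_sum[OF matrix_vector_mul_linear])

text \<open>Variation of constants, with the inputs indexed by their age so that the sum is a
  convolution with the powers of \<open>M\<close>.\<close>

lemma affine_orbit_eq:
  "affine_orbit M x0 d n = mat_power M n *v x0 + (\<Sum>i<n. mat_power M i *v d (n - 1 - i))"
proof (induction n)
  case (Suc n)
  have "(\<Sum>i<Suc n. mat_power M i *v d (Suc n - 1 - i)) =
      d n + (\<Sum>i<n. mat_power M (Suc i) *v d (n - 1 - i))"
    by (subst sum.lessThan_Suc_shift) simp
  then show ?case
    by (simp add: Suc matrix_vector_right_distrib matrix_vector_sum matrix_vector_mul_assoc)
qed simp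

section \<open>Quadratic forms of semidefinite and definite matrices\<close>

lemma psd_norm_square_le:
  assumes "psd S"
  shows "(norm (S *v x))\<^sup>2 \<le> (spectral_norm S + 1) * inner x (S *v x)"
proof -
  \<comment> \<open>Nonnegativity of the form at \<open>q x - S x\<close> gives the bound without a
    square root of \<open>S\<close>; the summand 1 keeps \<open>q\<close> positive when
    \<open>S = 0\<close>.\<close>
  define q y where "q = spectral_norm S + 1" and "y = S *v x"
  have q: "q > 0"
    using spectral_norm_nonneg[of S] by (simp add: q_def)
  have "inner x (S *v y) = inner y y"
    using assms by (simp add: psd_def inner_matrix_transpose y_def)
  then have "inner (q *\<^sub>R x - y) (S *v (q *\<^sub>R x - y)) =
      q * (q * inner x y) - 2 * q * inner y y + inner y (S *v y)"
    by (simp add: matrix_vector_mult_diff_distrib matrix_vector_mult_scaleR inner_diff algebra_simps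
      inner_commute flip: y_def)
  moreover have "inner (q *\<^sub>R x - y) (S *v (q *\<^sub>R x - y)) \<ge> 0"
    using assms by (auto simp: psd_def)
  moreover have "inner y (S *v y) \<le> q * inner y y"
    using inner_matrix_le_square[of y S] inner_ge_zero[of y]
    by (simp add: q_def dot_square_norm algebra_simps) (smt (verit) zero_le_power2)
  ultimately have "q * inner y y \<le> q * (q * inner x y)"
    by linarith
  with q show ?thesis
    by (simp add: q_def y_def dot_square_norm)
qed

lemma posdef_invertible:
  assumes "posdef S"
  shows "invertible S"
proof -
  have "S *v x = S *v y \<Longrightarrow> x = y" for x y
    using assms unfolding posdef_def
    by (metis inner_zero_right matrix_vector_mult_diff_distrib order_less_irrefl right_minus_eq)
  then show ?thesis
    by (simp add: invertible_left_inverse matrix_left_invertible_injective inj_def)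
qed

lemma
  assumes "invertible S"
  shows matrix_inv_left: "matrix_inv S ** S = mat 1" and matrix_inv_right: "S ** matrix_inv S = mat 1"
  using someI_ex[OF assms[unfolded invertible_def]] by (simp_all add: matrix_inv_def)

lemma posdef_imp_psd: "posdef S \<Longrightarrow> psd S"
  by (auto simp: posdef_def psd_def) (metis inner_zero_left less_imp_le order_refl)

lemma posdef_norm_square_le:
  assumes "posdef S"
  obtains c where "c > 0" "\<And>x. (norm x)\<^sup>2 \<le> c * inner x (S *v x)"
proof -
  define c where "c = (spectral_norm (matrix_inv S))\<^sup>2 * (spectral_norm S + 1)"
  have psd: "psd S" using assms by (rule posdef_imp_psd)
  have "(norm x)\<^sup>2 \<le> (c + 1) * inner x (S *v x)" for x
  proof -
    have "x = matrix_inv S *v (S *v x)"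
      using posdef_invertible[OF assms] by (simp add: matrix_vector_mul_assoc matrix_inv_left)
    then have "norm x \<le> spectral_norm (matrix_inv S) * norm (S *v x)"
      by (metis norm_matrix_le)
    then have "(norm x)\<^sup>2 \<le> (spectral_norm (matrix_inv S))\<^sup>2 * (norm (S *v x))\<^sup>2"
      by (rule order_trans[OF power_mono]) (simp_all add: power_mult_distrib)
    also have "\<dots> \<le> c * inner x (S *v x)"
      unfolding c_def mult.assoc by (intro mult_left_mono psd_norm_square_le psd) auto
    also have "\<dots> \<le> (c + 1) * inner x (S *v x)"
      using psd by (intro mult_right_mono) (auto simp: psd_def)
    finally show ?thesis .
  qed
  moreover have "c + 1 > 0"
    unfolding c_def by (smt (verit) spectral_norm_nonneg zero_le_power2 mult_nonneg_nonneg)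
  ultimately show ?thesis
    using that by blast
qed

section \<open>Completion of squares for the Riccati equation\<close>

locale lqr =
  fixes A Q P :: "real^'n^'n" and B :: "real^'d^'n" and R :: "real^'d^'d"
  assumes Q: "psd Q" and P: "psd P" and R: "posdef R" and riccati: "riccati_solution A B Q R P"
begin

definition "H = R + transpose B ** P ** B"
definition "K = lqr_gain A B R P"
definition "F = closed_loop A B R P"
text \<open>Turns a costate into the feedforward part of the control.\<close>

definition "L = matrix_inv H ** transpose B"

lemma P_sym: "inner x (P *v y) = inner y (P *v x)"
  using P by (metis inner_commute inner_matrix_transpose psd_def)

lemma P_nonneg: "0 \<le> inner x (P *v x)"
  using P by (simp add: psd_def)

lemma Q_nonneg: "0 \<le> inner x (Q *v x)"
  using Q by (simp add: psd_def)

lemma R_nonneg: "0 \<le> inner u (R *v u)"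
  using posdef_imp_psd[OF R] by (simp add: psd_def)

lemma H_mult: "H *v u = R *v u + transpose B *v (P *v (B *v u))"
  by (simp add: H_def matrix_vector_mult_add_rdistrib matrix_vector_mul_assoc matrix_mul_assoc)

lemma inner_H: "inner u (H *v v) = inner u (R *v v) + inner (B *v u) (P *v (B *v v))"
  by (simp add: H_mult inner_add_right inner_transpose_matrix)

lemma H_posdef: "posdef H"
  unfolding posdef_def
proof (intro conjI allI impI)
  have "transpose R = R" "transpose P = P"
    using R P by (auto simp: posdef_def psd_def)
  moreover have "transpose (R + Z) = transpose R + transpose Z" for Z :: "real^'d^'d"
    by (simp add: vec_eq_iff transpose_def)
  ultimately show "transpose H = H"
    by (simp add: H_def matrix_transpose_mul transpose_transpose matrix_mul_assoc)
  show "0 < inner u (H *v u)" if "u \<noteq> 0" for u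
    using that R P_nonneg[of "B *v u"] by (auto simp: inner_H posdef_def intro: add_pos_nonneg)
qed

lemma H_sym: "inner u (H *v v) = inner v (H *v u)"
  using H_posdef by (metis inner_commute inner_matrix_transpose posdef_def)

lemma H_inv: "H ** matrix_inv H = mat 1"
  using posdef_invertible[OF H_posdef] by (simp add: matrix_inv_right)

lemma H_L: "H *v (L *v y) = transpose B *v y"
  by (simp add: L_def matrix_vector_mul_assoc matrix_mul_assoc H_inv)

lemma H_K: "H *v (K *v x) = transpose B *v (P *v (A *v x))"
  by (simp add: K_def lqr_gain_def matrix_vector_mul_assoc matrix_mul_assoc H_inv flip: H_def)

lemma F_mult: "F *v x = A *v x - B *v (K *v x)"
  by (simp add: F_def closed_loop_def K_def matrix_vector_mul_assoc matrix_vector_mult_diff_rdistrib)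

lemma riccati_form:
  "inner x (P *v x) = inner x (Q *v x) + inner (A *v x) (P *v (A *v x)) - inner (K *v x) (H *v (K *v x))"
proof -
  have P_eq: "P = Q + transpose A ** P ** A - transpose A ** P ** B ** K"
    using riccati unfolding riccati_solution_def K_def lqr_gain_def H_def by (simp only: matrix_mul_assoc)
  have "P *v x = Q *v x + transpose A *v (P *v (A *v x)) - transpose A *v (P *v (B *v (K *v x)))"
    by (subst P_eq) (simp only: matrix_vector_mult_add_rdistrib matrix_vector_mult_diff_rdistrib
      matrix_vector_mul_assoc[symmetric])
  then have "inner x (P *v x) = inner x (Q *v x) + inner (A *v x) (P *v (A *v x))
      - inner (A *v x) (P *v (B *v (K *v x)))"
    by (simp only: inner_add_right inner_diff_right inner_transpose_matrix)
  moreover have "inner (K *v x) (H *v (K *v x)) = inner (A *v x) (P *v (B *v (K *v x)))"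
    by (simp add: H_K P_sym[of "A *v x"] inner_transpose_matrix)
  ultimately show ?thesis by simp
qed

text \<open>One backward step of dynamic programming for a value function
  \<open>x . P x + 2 p . x\<close> plus a constant. The Riccati equation reproduces the quadratic
  part, and the linear part \<open>p\<close> becomes \<open>transpose F *v \<psi>\<close>; the
  square \<open>e . H e\<close> is the loss against the minimizing control.\<close>

lemma complete_square:
  fixes w p \<psi> x :: "real^'n" and u :: "real^'d"
  assumes x': "x' = A *v x + B *v u + w" and psi: "\<psi> = P *v w + p"
    and e: "e = u + K *v x + L *v \<psi>"
  shows "inner x (Q *v x) + inner u (R *v u) + inner x' (P *v x') + 2 * inner p x' =
    inner x (P *v x) + 2 * inner (transpose F *v \<psi>) x
      + (inner w (P *v w) + 2 * inner p w - inner \<psi> (B *v (L *v \<psi>))) + inner e (H *v e)"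
proof -
  define h where "h = L *v \<psi>"
  have uh: "inner v (H *v h) = inner \<psi> (B *v v)" for v
    by (simp add: h_def H_L inner_transpose_matrix) (simp add: inner_commute)
  have uk: "inner v (H *v (K *v x)) = inner (B *v v) (P *v (A *v x))" for v
    by (simp add: H_K inner_transpose_matrix)
  have "inner e (H *v e) = inner u (H *v u) + 2 * inner u (H *v (K *v x)) + 2 * inner u (H *v h)
      + inner (K *v x) (H *v (K *v x)) + 2 * inner (K *v x) (H *v h) + inner h (H *v h)"
    unfolding e h_def[symmetric]
    using H_sym[of u h] H_sym[of u "K *v x"] H_sym[of "K *v x" h]
    by (simp add: matrix_vector_right_distrib inner_add algebra_simps)
  then have "inner e (H *v e) = inner u (R *v u) + inner (B *v u) (P *v (B *v u))
      + 2 * inner (B *v u) (P *v (A *v x)) + 2 * inner \<psi> (B *v u)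
      + inner (K *v x) (H *v (K *v x)) + 2 * inner \<psi> (B *v (K *v x)) + inner \<psi> (B *v h)"
    by (simp only: uh uk inner_H[of u u])
  moreover have "inner x' (P *v x') = inner (A *v x) (P *v (A *v x)) + inner (B *v u) (P *v (B *v u))
      + inner w (P *v w) + 2 * inner (B *v u) (P *v (A *v x)) + 2 * inner (P *v w) (A *v x)
      + 2 * inner (P *v w) (B *v u)"
    unfolding x'
    using P_sym[of "A *v x" "B *v u"] P_sym[of "A *v x" w] P_sym[of "B *v u" w]
    by (simp add: matrix_vector_right_distrib inner_add algebra_simps inner_commute)
  moreover have "inner (transpose F *v \<psi>) x = inner \<psi> (A *v x) - inner \<psi> (B *v (K *v x))"
    by (simp add: F_mult inner_diff_right flip: inner_matrix_transpose)
  moreover have "inner \<psi> y = inner (P *v w) y + inner p y" for y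
    by (simp add: psi inner_add_left)
  moreover have "inner p x' = inner p (A *v x) + inner p (B *v u) + inner p w"
    by (simp add: x' inner_add_right)
  ultimately show ?thesis
    using riccati_form[of x] unfolding h_def by (smt (verit))
qed

text \<open>The case of \<open>complete_square\<close> with no disturbance, no linear term and
  \<open>u = - K x\<close>, where the deviation \<open>e\<close> is zero.\<close>

lemma lyapunov:
  "inner x (P *v x) = inner x (Q *v x) + inner (K *v x) (R *v (K *v x)) + inner (F *v x) (P *v (F *v x))"
proof -
  have "F *v x = A *v x + B *v (- (K *v x)) + 0"
    by (simp add: F_mult linear_neg[OF matrix_vector_mul_linear])
  from complete_square[OF this, of 0 0 0] show ?thesis
    by (simp add: linear_neg[OF matrix_vector_mul_linear])
qed

end

section \<open>Stability of the closed loop\<close>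

lemma exp_stable_tendsto:
  assumes "exp_stable M C r"
  shows "(\<lambda>k. mat_power M k *v x) \<longlonglongrightarrow> 0"
proof -
  have C: "C > 0" "0 < r" "r < 1" "\<And>k. spectral_norm (mat_power M k) \<le> C * r ^ k"
    using assms by (auto simp: exp_stable_def)
  have "(\<lambda>k. r ^ k) \<longlonglongrightarrow> 0"
    using C by (simp add: LIMSEQ_realpow_zero)
  then have "(\<lambda>k. C * r ^ k * norm x) \<longlonglongrightarrow> C * 0 * norm x"
    by (intro tendsto_mult tendsto_const)
  then have lim: "(\<lambda>k. C * r ^ k * norm x) \<longlonglongrightarrow> 0" by simp
  have "norm (mat_power M k *v x) \<le> C * r ^ k * norm x" for k
    by (rule order_trans[OF norm_matrix_le]) (intro mult_right_mono C, auto)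
  then show ?thesis
    by (intro Lim_null_comparison[OF _ lim] always_eventually allI)
qed

text \<open>Duality: the transpose of a gain that stabilizes the transposed pair is a stabilizing
  output injection for \<open>(A, C)\<close>.\<close>

lemma detectable_imp_exp_stable:
  assumes "detectable A C"
  obtains L c r where "exp_stable (A - L ** C) c r"
proof -
  obtain K where K: "spec_radius (transpose A - transpose C ** K) < 1"
    using assms by (auto simp: detectable_def stabilizable_def)
  obtain r where r: "spec_radius (transpose A - transpose C ** K) < r" "r < 1"
    using dense[OF K] by blast
  then obtain c where c: "exp_stable (transpose A - transpose C ** K) c r"
    using spec_radius_imp_exp_stable by blast
  have diff: "transpose (X - Y) = transpose X - transpose Y" for X Y :: "real^'n^'n"
    by (simp add: vec_eq_iff transpose_def)
  have "transpose A - transpose C ** K = transpose (A - transpose K ** C)"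
    by (simp add: diff matrix_transpose_mul transpose_transpose)
  with c have "exp_stable (A - transpose K ** C) c r"
    by (simp add: exp_stable_transpose)
  then show ?thesis using that by blast
qed

text \<open>Real and imaginary part of a complex eigenvector; staying with real vectors lets the
  real quadratic forms be applied directly.\<close>

lemma real_eigenpair:
  fixes M :: "real^'n^'n"
  assumes "z \<in> complex_eigenvalues M"
  obtains a b where "a \<noteq> 0 \<or> b \<noteq> 0"
    "M *v a = Re z *\<^sub>R a - Im z *\<^sub>R b" "M *v b = Im z *\<^sub>R a + Re z *\<^sub>R b"
proof -
  obtain v where v: "v \<noteq> 0" "map_matrix complex_of_real M *v v = z *s v"
    using assms by (auto simp: complex_eigenvalues_def)
  define a b where "a = (\<chi> i. Re (v $ i))" and "b = (\<chi> i. Im (v $ i))"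
  have eq: "(\<Sum>j\<in>UNIV. complex_of_real (M $ i $ j) * v $ j) = z * v $ i" for i
    using v(2) by (simp add: vec_eq_iff matrix_vector_mult_def map_matrix_def)
  show ?thesis
  proof
    show "a \<noteq> 0 \<or> b \<noteq> 0"
      using v(1) by (auto simp: a_def b_def vec_eq_iff complex_eq_iff)
    show "M *v a = Re z *\<^sub>R a - Im z *\<^sub>R b"
      using arg_cong[OF eq, of Re] by (simp add: vec_eq_iff matrix_vector_mult_def a_def b_def)
    show "M *v b = Im z *\<^sub>R a + Re z *\<^sub>R b"
      using arg_cong[OF eq, of Im] by (simp add: vec_eq_iff matrix_vector_mult_def a_def b_def)
  qed
qed

text \<open>The cross terms cancel: \<open>q a + q b\<close> is the real part of the sesquilinear
  form of \<open>S\<close> at \<open>a + i b\<close>, and multiplying this vector by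
  \<open>s + i t\<close> scales it by the squared modulus.\<close>

lemma real_eigenpair_quadratic:
  fixes a b :: "real^'n" and S :: "real^'n^'n"
  defines "q \<equiv> \<lambda>x. inner x (S *v x)"
  shows "q (s *\<^sub>R a - t *\<^sub>R b) + q (t *\<^sub>R a + s *\<^sub>R b) = (s\<^sup>2 + t\<^sup>2) * (q a + q b)"
  by (simp add: q_def matrix_vector_right_distrib matrix_vector_mult_diff_distrib
    linear_cmul[OF matrix_vector_mul_linear] inner_add inner_diff power2_eq_square algebra_simps)

context lqr
begin

text \<open>On an eigenvector of \<open>F\<close> with eigenvalue of modulus at least 1 the Lyapunov equation forces
  the stage cost to vanish, so that it is an eigenvector of every \<open>A - M Q\<close>.\<close>

lemma spec_radius_F:
  assumes "detectable A Q"
  shows "spec_radius F < 1"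
  unfolding spec_radius_less_iff
proof (intro ballI, rule ccontr)
  fix z assume z: "z \<in> complex_eigenvalues F" and "\<not> cmod z < 1"
  then have z1: "(Re z)\<^sup>2 + (Im z)\<^sup>2 \<ge> 1"
    using one_le_power[of "cmod z" 2] by (simp add: cmod_power2)
  obtain a b where ab: "a \<noteq> 0 \<or> b \<noteq> 0"
    and Fa: "F *v a = Re z *\<^sub>R a - Im z *\<^sub>R b" and Fb: "F *v b = Im z *\<^sub>R a + Re z *\<^sub>R b"
    using real_eigenpair[OF z] .
  have "inner a (P *v a) + inner b (P *v b) \<ge> 0"
    using P_nonneg by (simp add: add_nonneg_nonneg)
  then have "inner (F *v a) (P *v (F *v a)) + inner (F *v b) (P *v (F *v b))
      \<ge> 1 * (inner a (P *v a) + inner b (P *v b))"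
    unfolding Fa Fb using z1 unfolding real_eigenpair_quadratic by (intro mult_right_mono) auto
  then have "inner a (Q *v a) + inner (K *v a) (R *v (K *v a))
      + inner b (Q *v b) + inner (K *v b) (R *v (K *v b)) \<le> 0"
    using lyapunov[of a] lyapunov[of b] by argo
  then have zero: "inner x (Q *v x) = 0 \<and> inner (K *v x) (R *v (K *v x)) = 0" if "x = a \<or> x = b" for x
    using that Q_nonneg[of a] Q_nonneg[of b] R_nonneg[of "K *v a"] R_nonneg[of "K *v b"]
    by (auto intro: antisym)
  have Qx: "Q *v x = 0" and Kx: "K *v x = 0" if "x = a \<or> x = b" for x
    using zero[OF that] psd_norm_square_le[OF Q, of x] R by (auto simp: posdef_def)
  obtain M c r where M: "exp_stable (A - M ** Q) c r"
    using detectable_imp_exp_stable[OF assms] .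
  have "(A - M ** Q) *v x = F *v x" if "x = a \<or> x = b" for x
    using Qx[OF that] Kx[OF that]
    by (simp add: F_mult matrix_vector_mult_diff_rdistrib flip: matrix_vector_mul_assoc)
  then have Ma: "(A - M ** Q) *v a = Re z *\<^sub>R a - Im z *\<^sub>R b"
    and Mb: "(A - M ** Q) *v b = Im z *\<^sub>R a + Re z *\<^sub>R b"
    using Fa Fb by auto
  define T where "T k = mat_power (A - M ** Q) k" for k
  \<comment> \<open>Each power of \<open>A - M ** Q\<close> multiplies the complex vector
    \<open>a + i b\<close> by \<open>z\<close>, so \<open>g\<close> cannot decrease, while
    exponential stability drives it to 0.\<close>
  define g where "g k = (norm (T k *v a))\<^sup>2 + (norm (T k *v b))\<^sup>2" for k
  have "g k \<ge> g 0" for k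
  proof (induction k)
    case (Suc k)
    have "T (Suc k) *v x = T k *v ((A - M ** Q) *v x)" for x
      by (simp add: T_def matrix_vector_mul_assoc mat_power_commute)
    then have "T (Suc k) *v a = Re z *\<^sub>R (T k *v a) - Im z *\<^sub>R (T k *v b)"
      "T (Suc k) *v b = Im z *\<^sub>R (T k *v a) + Re z *\<^sub>R (T k *v b)"
      by (simp_all add: Ma Mb matrix_vector_right_distrib matrix_vector_mult_diff_distrib
        linear_cmul[OF matrix_vector_mul_linear])
    then have "g (Suc k) = ((Re z)\<^sup>2 + (Im z)\<^sup>2) * g k"
      using real_eigenpair_quadratic[of "Re z" "T k *v a" "Im z" "T k *v b" "mat 1"]
      by (simp add: g_def dot_square_norm)
    moreover have "1 * g k \<le> ((Re z)\<^sup>2 + (Im z)\<^sup>2) * g k"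
      using z1 by (intro mult_right_mono) (auto simp: g_def)
    ultimately show ?case using Suc by simp
  qed simp
  moreover have "g \<longlonglongrightarrow> (norm (0::real^'n))\<^sup>2 + (norm (0::real^'n))\<^sup>2"
    unfolding g_def T_def by (intro tendsto_add tendsto_power tendsto_norm exp_stable_tendsto[OF M])
  ultimately have "g 0 \<le> 0"
    by (simp add: LIMSEQ_le_const)
  then show False
    using ab by (simp add: g_def T_def sum_power2_le_zero_iff)
qed

section \<open>Deviations from the optimal feedback\<close>

text \<open>Truncated subtraction makes the sum empty from time \<open>N\<close> on, so a costate
  taken past the horizon, as in \<open>costate T w (t + k)\<close>, is zero.\<close>

definition costate :: "nat \<Rightarrow> (nat \<Rightarrow> real^'n) \<Rightarrow> nat \<Rightarrow> real^'n" where
  "costate N v t = (\<Sum>i<N - t. mat_power (transpose F) i *v (P *v v (t + i)))"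

lemma costate_end [simp]: "N \<le> t \<Longrightarrow> costate N v t = 0"
  by (simp add: costate_def)

lemma costate_step:
  assumes "t < N"
  shows "costate N v t = P *v v t + transpose F *v costate N v (Suc t)"
proof -
  have "N - t = Suc (N - Suc t)"
    using assms by simp
  then show ?thesis
    unfolding costate_def by (simp only: sum.lessThan_Suc_shift) (simp add: matrix_vector_sum flip: matrix_vector_mul_assoc)
qed

lemma costate_cong: "(\<And>s. s < N \<Longrightarrow> v s = v' s) \<Longrightarrow> costate N v t = costate N v' t"
  unfolding costate_def by (intro sum.cong) auto

lemma costate_truncation:
  assumes "\<And>s. s \<ge> N \<Longrightarrow> v s = 0"
  shows "costate N v t = costate k (\<lambda>i. v (t + i)) 0 + mat_power (transpose F) k *v costate N v (t + k)"
proof -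
  define f where "f i = mat_power (transpose F) i *v (P *v v (t + i))" for i
  have f: "f i = 0" if "i \<ge> N - t" for i
    using that assms by (simp add: f_def)
  have "costate N v t = (\<Sum>i<N - t. f i)"
    by (simp add: costate_def f_def)
  \<comment> \<open>The new length is the maximum of \<open>k\<close> and \<open>N - t\<close>;
    terms past the horizon vanish because \<open>v\<close> does.\<close>
  also have "\<dots> = (\<Sum>i<k + (N - (t + k)). f i)"
    by (rule sum.mono_neutral_left) (auto simp: f)
  also have "\<dots> = (\<Sum>i<k. f i) + (\<Sum>i<N - (t + k). f (k + i))"
    by (rule sum_lessThan_add)
  also have "(\<Sum>i<N - (t + k). f (k + i)) = mat_power (transpose F) k *v costate N v (t + k)"
    by (simp add: costate_def f_def matrix_vector_sum mat_power_add add.assoc flip: matrix_vector_mul_assoc)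
  finally show ?thesis
    by (simp add: costate_def f_def)
qed

text \<open>The optimal value for terminal weight \<open>P\<close>, that is, the constant that
  remains once all squares are completed.\<close>

definition base_cost :: "real^'n \<Rightarrow> nat \<Rightarrow> (nat \<Rightarrow> real^'n) \<Rightarrow> real" where
  "base_cost x0 N v = inner x0 (P *v x0) + 2 * inner (transpose F *v costate N v 0) x0
     + (\<Sum>t<N. inner (v t) (P *v v t) + 2 * inner (transpose F *v costate N v (Suc t)) (v t)
         - inner (costate N v t) (B *v (L *v costate N v t)))"

definition deviation :: "real^'n \<Rightarrow> nat \<Rightarrow> (nat \<Rightarrow> real^'n) \<Rightarrow> (nat \<Rightarrow> real^'d) \<Rightarrow> nat \<Rightarrow> real^'d" where
  "deviation x0 N v u t = u t + K *v state A B x0 v u t + L *v costate N v t"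

lemma cost_eq_base_plus_deviation:
  "cost A B Q R P x0 N v u =
     base_cost x0 N v + (\<Sum>t<N. inner (deviation x0 N v u t) (H *v deviation x0 N v u t))"
proof -
  define x where "x = state A B x0 v u"
  \<comment> \<open>The induction shortens the horizon to \<open>n\<close> but keeps the costate of
    the full horizon \<open>N\<close>; the linear terminal term that this requires vanishes at
    \<open>n = N\<close>.\<close>
  have "(\<Sum>t<n. inner (x t) (Q *v x t) + inner (u t) (R *v u t)) + inner (x n) (P *v x n)
        + 2 * inner (transpose F *v costate N v n) (x n)
      = inner x0 (P *v x0) + 2 * inner (transpose F *v costate N v 0) x0
        + (\<Sum>t<n. inner (v t) (P *v v t) + 2 * inner (transpose F *v costate N v (Suc t)) (v t)
          - inner (costate N v t) (B *v (L *v costate N v t)))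
        + (\<Sum>t<n. inner (deviation x0 N v u t) (H *v deviation x0 N v u t))" if "n \<le> N" for n
    using that
  proof (induction n)
    case 0
    then show ?case by (simp add: x_def)
  next
    case (Suc n)
    have step: "x (Suc n) = A *v x n + B *v u n + v n"
      by (simp add: x_def)
    have "costate N v n = P *v v n + transpose F *v costate N v (Suc n)"
      using Suc.prems by (simp add: costate_step)
    from complete_square[OF step this deviation_def[of x0 N v u n, folded x_def]] Suc
    show ?case by simp
  qed
  from this[of N] show ?thesis
    by (simp add: cost_def base_cost_def x_def)
qed

lemma H_nonneg: "0 \<le> inner e (H *v e)"
  using posdef_imp_psd[OF H_posdef] by (simp add: psd_def)

lemma base_cost_le: "base_cost x0 N v \<le> cost A B Q R P x0 N v u"
  by (simp add: cost_eq_base_plus_deviation sum_nonneg H_nonneg)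

text \<open>Controls are sequences that cannot refer to the state, so the closed-loop trajectory is
  inserted explicitly as an \<open>affine_orbit\<close>.\<close>

definition feedback :: "real^'n \<Rightarrow> (nat \<Rightarrow> real^'n) \<Rightarrow> (nat \<Rightarrow> real^'n) \<Rightarrow> nat \<Rightarrow> real^'d" where
  "feedback x0 v \<phi> t = - (K *v affine_orbit F x0 (\<lambda>s. v s - B *v (L *v \<phi> s)) t) - L *v \<phi> t"

lemma state_feedback:
  "state A B x0 v (feedback x0 v \<phi>) t = affine_orbit F x0 (\<lambda>s. v s - B *v (L *v \<phi> s)) t"
  by (induction t) (simp_all add: feedback_def F_mult algebra_simps matrix_vector_mult_diff_distrib
    linear_neg[OF matrix_vector_mul_linear])

lemma deviation_feedback: "deviation x0 N v (feedback x0 v (costate N v)) t = 0"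
  by (simp add: deviation_def state_feedback feedback_def)

text \<open>\<open>arg_min\<close> is a choice operator, so a minimizer must be exhibited first: the
  feedback with the predicted costate attains \<open>base_cost\<close>. Every minimizer then has
  zero deviation at times below \<open>k\<close>, and \<open>k \<ge> 1\<close> puts time 0 among
  them.\<close>

lemma mpc_action_eq:
  assumes "k \<ge> 1"
  shows "mpc_action A B Q R P k x v = - (K *v x) - L *v costate k v 0"
proof -
  define u0 where "u0 = feedback x v (costate k v)"
  have u0: "cost A B Q R P x k v u0 = base_cost x k v"
    by (simp add: cost_eq_base_plus_deviation u0_def deviation_feedback)
  define u where "u = mpc_plan A B Q R P k x v"
  have "is_arg_min (cost A B Q R P x k v) (\<lambda>_. True) u0"
    using base_cost_le by (auto simp: is_arg_min_def u0 not_less)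
  then have "is_arg_min (cost A B Q R P x k v) (\<lambda>_. True) u"
    unfolding u_def mpc_plan_def arg_min_def by (rule someI[of "is_arg_min _ _"])
  then have "cost A B Q R P x k v u \<le> base_cost x k v"
    unfolding is_arg_min_def using u0 by (metis not_less)
  then have "(\<Sum>t<k. inner (deviation x k v u t) (H *v deviation x k v u t)) \<le> 0"
    by (simp add: cost_eq_base_plus_deviation)
  moreover have "inner (deviation x k v u 0) (H *v deviation x k v u 0) \<le>
      (\<Sum>t<k. inner (deviation x k v u t) (H *v deviation x k v u t))"
    using assms by (intro member_le_sum) (auto simp: H_nonneg)
  ultimately have "deviation x k v u 0 = 0"
    using H_posdef unfolding posdef_def by (meson not_less order_trans)
  then show ?thesis
    by (simp add: mpc_action_def deviation_def algebra_simps eq_neg_iff_add_eq_0 flip: u_def)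
qed

end

section \<open>Bounds for single disturbance sequences\<close>

lemma norm_add_square_le: "(norm (x + y))\<^sup>2 \<le> 2 * (norm x)\<^sup>2 + 2 * (norm y)\<^sup>2"
  for x y :: "'a::real_inner"
  using zero_le_power2[of "norm (x - y)"]
  by (simp add: power2_norm_eq_inner inner_add inner_diff algebra_simps inner_commute)

lemma norm_matrix_square_le: "(norm (M *v x))\<^sup>2 \<le> (spectral_norm M)\<^sup>2 * (norm x)\<^sup>2"
  by (rule order_trans[OF power_mono[OF norm_matrix_le]]) (simp_all add: power_mult_distrib)

lemma state_diff:
  "state A B x0 w u t - state A B x0 w u' t = state A B 0 (\<lambda>_. 0) (\<lambda>s. u s - u' s) t"
  by (induction t) (simp_all add: matrix_vector_mult_diff_distrib algebra_simps flip: matrix_vector_right_distrib)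

lemma cost_terminal:
  "cost A B Q R S x0 N w u = cost A B Q R S' x0 N w u
     + inner (state A B x0 w u N) (S *v state A B x0 w u N)
     - inner (state A B x0 w u N) (S' *v state A B x0 w u N)"
  by (simp add: cost_def)

context lqr
begin

text \<open>Output injection: the system driven from 0 is stable after feeding back \<open>Q x\<close>, so that
  its terminal state is controlled by the stage costs, uniformly in the horizon.\<close>

lemma terminal_state_le_cost:
  assumes "detectable A Q"
  obtains c where "c > 0"
    "\<And>T u. (norm (state A B 0 (\<lambda>_. 0) u T))\<^sup>2 \<le> c * cost A B Q R 0 0 T (\<lambda>_. 0) u"
proof -
  obtain M C r where M: "exp_stable (A - M ** Q) C r"
    using detectable_imp_exp_stable[OF assms] .
  then have C: "C > 0" "0 < r" "r < 1"
    by (auto simp: exp_stable_def)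
  obtain \<rho> where \<rho>: "\<rho> > 0" "\<And>u. (norm u)\<^sup>2 \<le> \<rho> * inner u (R *v u)"
    using posdef_norm_square_le[OF R] by blast
  \<comment> \<open>Splitting the square of \<open>d t\<close> costs the factors 2;
    \<open>psd_norm_square_le\<close> converts \<open>Q y\<close> into state cost and
    \<open>\<rho>\<close> converts the control into control cost.\<close>
  define a where "a = 2 * (spectral_norm M)\<^sup>2 * (spectral_norm Q + 1)"
  define b where "b = 2 * (spectral_norm B)\<^sup>2 * \<rho>"
  define c where "c = C\<^sup>2 / (1 - r) * (a + b)"
  have ab: "a \<ge> 0" "b \<ge> 0"
    using \<rho> spectral_norm_nonneg[of Q] by (auto simp: a_def b_def)
  then have c: "c \<ge> 0"
    using C by (simp add: c_def)
  have "(norm (state A B 0 (\<lambda>_. 0) u T))\<^sup>2 \<le> (c + 1) * cost A B Q R 0 0 T (\<lambda>_. 0) u" for T u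
  proof -
    define y where "y = state A B 0 (\<lambda>_. 0) u"
    define g where "g t = inner (y t) (Q *v y t) + inner (u t) (R *v u t)" for t
    define d where "d t = M *v (Q *v y t) + B *v u t" for t
    have g0: "g t \<ge> 0" for t
      by (simp add: g_def Q_nonneg R_nonneg)
    have d: "(norm (d t))\<^sup>2 \<le> (a + b) * g t" for t
    proof -
      have "(norm (d t))\<^sup>2 \<le> 2 * (norm (M *v (Q *v y t)))\<^sup>2 + 2 * (norm (B *v u t))\<^sup>2"
        unfolding d_def by (rule norm_add_square_le)
      also have "\<dots> \<le> 2 * ((spectral_norm M)\<^sup>2 * (norm (Q *v y t))\<^sup>2)
          + 2 * ((spectral_norm B)\<^sup>2 * (norm (u t))\<^sup>2)"
        by (intro add_mono mult_left_mono norm_matrix_square_le) auto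
      also have "\<dots> \<le> 2 * ((spectral_norm M)\<^sup>2 * ((spectral_norm Q + 1) * inner (y t) (Q *v y t)))
          + 2 * ((spectral_norm B)\<^sup>2 * (\<rho> * inner (u t) (R *v u t)))"
        by (intro add_mono mult_left_mono psd_norm_square_le Q \<rho>) auto
      also have "\<dots> = a * inner (y t) (Q *v y t) + b * inner (u t) (R *v u t)"
        by (simp add: a_def b_def)
      also have "\<dots> \<le> (a + b) * inner (y t) (Q *v y t) + (a + b) * inner (u t) (R *v u t)"
        using ab by (intro add_mono mult_right_mono Q_nonneg R_nonneg) auto
      finally show ?thesis by (simp add: g_def distrib_left)
    qed
    have "y T = affine_orbit (A - M ** Q) 0 d T"
      unfolding y_def
      by (induction T) (simp_all add: d_def y_def matrix_vector_mult_diff_rdistrib flip: matrix_vector_mul_assoc)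
    then have "(norm (y T))\<^sup>2 \<le> C\<^sup>2 / (1 - r) * (\<Sum>i<T. r ^ i * (norm (d (T - 1 - i)))\<^sup>2)"
      using exp_stable_convolution[OF M, of "\<lambda>i. d (T - 1 - i)" T] by (simp add: affine_orbit_eq)
    also have "\<dots> \<le> C\<^sup>2 / (1 - r) * (\<Sum>i<T. 1 * ((a + b) * g (T - 1 - i)))"
      using C d by (intro mult_left_mono sum_mono mult_mono) (auto intro: power_le_one)
    also have "(\<Sum>i<T. 1 * ((a + b) * g (T - 1 - i))) = (a + b) * (\<Sum>i<T. g i)"
      using sum.nat_diff_reindex[of g T] by (simp add: sum_distrib_left[symmetric])
    also have "C\<^sup>2 / (1 - r) * \<dots> = c * (\<Sum>i<T. g i)"
      by (simp add: c_def)
    also have "\<dots> \<le> (c + 1) * (\<Sum>i<T. g i)"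
      using g0 by (intro mult_right_mono) (auto simp: sum_nonneg)
    finally show ?thesis
      by (simp add: cost_def g_def y_def)
  qed
  with c show ?thesis
    by (intro that[of "c + 1"]) auto
qed

definition offline_state :: "real^'n \<Rightarrow> nat \<Rightarrow> (nat \<Rightarrow> real^'n) \<Rightarrow> nat \<Rightarrow> real^'n" where
  "offline_state x0 T w = affine_orbit F x0 (\<lambda>s. w s - B *v (L *v costate T w s))"

text \<open>Let \<open>x\<close> be the terminal state optimal for \<open>P\<close> and
  \<open>x + y\<close> the actual one. Replacing the weight \<open>P\<close> by \<open>Qf\<close>
  removes \<open>y . P y\<close>, which the excess cost contains as well, so the two cancel. Only
  \<open>x . P x\<close> and a term linear in \<open>y\<close> are lost, and the stage costs grow
  quadratically in \<open>y\<close>.\<close>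

lemma cost_lower_bound:
  assumes "detectable A Q"
  obtains D where "D \<ge> 0" "\<And>Qf x0 T w u. psd Qf \<Longrightarrow>
    base_cost x0 T w - D * (norm (offline_state x0 T w T))\<^sup>2 \<le> cost A B Q R Qf x0 T w u"
proof -
  obtain c where c: "c > 0"
    "\<And>T u. (norm (state A B 0 (\<lambda>_. 0) u T))\<^sup>2 \<le> c * cost A B Q R 0 0 T (\<lambda>_. 0) u"
    using terminal_state_le_cost[OF assms] by blast
  \<comment> \<open>The first summand bounds \<open>x . P x\<close>; the second is what Young's
    inequality leaves of \<open>2 y . P x\<close> when its other part, the square of
    \<open>norm y\<close> over \<open>c\<close>, is absorbed by the stage costs.\<close>
  define D where "D = spectral_norm P + c * (spectral_norm P)\<^sup>2"
  have "base_cost x0 T w - D * (norm (offline_state x0 T w T))\<^sup>2 \<le> cost A B Q R Qf x0 T w u"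
    if Qf: "psd Qf" for Qf x0 T w u
  proof -
    define u0 where "u0 = feedback x0 w (costate T w)"
    define x where "x = offline_state x0 T w T"
    define v where "v s = u s - u0 s" for s
    define y where "y = state A B 0 (\<lambda>_. 0) v T"
    have u0: "state A B x0 w u0 t = offline_state x0 T w t" for t
      by (simp add: u0_def offline_state_def state_feedback)
    have xT: "state A B x0 w u T = x + y"
      using state_diff[of A B x0 w u T u0] by (simp add: x_def y_def v_def[abs_def] u0 algebra_simps)
    have [simp]: "costate T (\<lambda>_. 0) t = 0" for t
      by (simp add: costate_def)
    have [simp]: "base_cost 0 T (\<lambda>_. 0) = 0"
      by (simp add: base_cost_def)
    \<comment> \<open>Deviations are affine in the control and that of \<open>u0\<close> is zero.
      Hence the excess cost of \<open>u\<close> is the full cost of \<open>v\<close> in the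
      undisturbed system started at 0, without cross terms.\<close>
    have "deviation x0 T w u t = deviation 0 T (\<lambda>_. 0) v t" for t
      using deviation_feedback[of x0 T w t] state_diff[of A B x0 w u t u0]
      by (simp add: deviation_def v_def[abs_def] u0_def[symmetric] matrix_vector_mult_diff_distrib
        algebra_simps flip: state_diff)
    then have "cost A B Q R P x0 T w u = base_cost x0 T w + cost A B Q R P 0 T (\<lambda>_. 0) v"
      by (simp add: cost_eq_base_plus_deviation)
    also have "cost A B Q R P 0 T (\<lambda>_. 0) v = cost A B Q R 0 0 T (\<lambda>_. 0) v + inner y (P *v y)"
      by (simp add: cost_def y_def)
    finally have "cost A B Q R Qf x0 T w u = base_cost x0 T w + cost A B Q R 0 0 T (\<lambda>_. 0) v
        + inner y (P *v y) + inner (x + y) (Qf *v (x + y)) - inner (x + y) (P *v (x + y))"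
      using cost_terminal[of A B Q R Qf x0 T w u P] by (simp add: xT)
    moreover have "inner (x + y) (Qf *v (x + y)) \<ge> 0"
      using Qf by (simp add: psd_def)
    moreover have "inner (x + y) (P *v (x + y)) = inner x (P *v x) + 2 * inner y (P *v x) + inner y (P *v y)"
      using P_sym[of x y] by (simp add: matrix_vector_right_distrib inner_add)
    moreover have "inner x (P *v x) \<le> spectral_norm P * (norm x)\<^sup>2"
      using inner_matrix_le_square[of x P] by linarith
    moreover have "2 * inner y (P *v x) \<le> (norm y)\<^sup>2 / c + c * (norm (P *v x))\<^sup>2"
    proof -
      have "0 \<le> (norm (y - c *\<^sub>R (P *v x)))\<^sup>2"
        by simp
      then have "2 * c * inner y (P *v x) \<le> (norm y)\<^sup>2 + c * c * (norm (P *v x))\<^sup>2"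
        by (simp add: power2_norm_eq_inner inner_diff algebra_simps inner_commute)
      then show ?thesis
        using c(1) by (simp add: field_simps)
    qed
    moreover have "c * (norm (P *v x))\<^sup>2 \<le> c * ((spectral_norm P)\<^sup>2 * (norm x)\<^sup>2)"
      using c(1) by (intro mult_left_mono norm_matrix_square_le) auto
    moreover have "(norm y)\<^sup>2 / c \<le> cost A B Q R 0 0 T (\<lambda>_. 0) v"
      using c(2)[of v T] c(1) by (simp add: y_def field_simps)
    ultimately show ?thesis
      by (simp add: D_def x_def[symmetric] algebra_simps)
  qed
  moreover have "D \<ge> 0"
    using c(1) spectral_norm_nonneg[of P] by (simp add: D_def)
  ultimately show ?thesis
    using that by blast
qed

section \<open>Trajectory and cost under MPC\<close>

definition mpc_costate :: "nat \<Rightarrow> nat \<Rightarrow> (nat \<Rightarrow> real^'n) \<Rightarrow> nat \<Rightarrow> real^'n" where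
  "mpc_costate k T w t = costate k (\<lambda>i. cut_off T w (t + i)) 0"

definition mpc_orbit :: "real^'n \<Rightarrow> nat \<Rightarrow> nat \<Rightarrow> (nat \<Rightarrow> real^'n) \<Rightarrow> nat \<Rightarrow> real^'n" where
  "mpc_orbit x0 k T w = affine_orbit F x0 (\<lambda>s. cut_off T w s - B *v (L *v mpc_costate k T w s))"

lemma mpc_state_eq:
  assumes "k \<ge> 1"
  shows "mpc_state A B Q R P k x0 (cut_off T w) t = mpc_orbit x0 k T w t"
  using assms
  by (induction t) (simp_all add: mpc_orbit_def mpc_action_eq mpc_costate_def F_mult
    matrix_vector_mult_diff_distrib linear_neg[OF matrix_vector_mul_linear])

lemma mpc_input_eq:
  assumes "k \<ge> 1"
  shows "mpc_input A B Q R P k x0 (cut_off T w) t =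
    - (K *v mpc_orbit x0 k T w t) - L *v mpc_costate k T w t"
  using assms by (simp add: mpc_input_def mpc_state_eq mpc_action_eq mpc_costate_def)

text \<open>The system is driven by \<open>w\<close> and the orbit by \<open>cut_off T w\<close>;
  these agree before \<open>T\<close>, hence the states agree up to \<open>T\<close>.\<close>

lemma state_mpc_input:
  assumes "k \<ge> 1" "t \<le> T"
  shows "state A B x0 w (mpc_input A B Q R P k x0 (cut_off T w)) t = mpc_orbit x0 k T w t"
  using assms(2)
proof (induction t)
  case (Suc t)
  then have "cut_off T w t = w t"
    by (simp add: cut_off_def)
  with Suc show ?case
    by (simp add: mpc_input_eq[OF assms(1)])
      (simp add: mpc_orbit_def F_mult matrix_vector_mult_diff_distrib linear_neg[OF matrix_vector_mul_linear])
qed (simp add: mpc_orbit_def)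

text \<open>Both feedback laws are evaluated at the same MPC state, so the terms with
  \<open>K\<close> cancel and only the tail of the costate beyond the predictions remains.\<close>

lemma deviation_mpc:
  assumes "k \<ge> 1" "t < T"
  shows "deviation x0 T w (mpc_input A B Q R P k x0 (cut_off T w)) t =
    L *v (mat_power (transpose F) k *v costate T w (t + k))"
proof -
  have eq: "costate T w s = costate T (cut_off T w) s" for s
    by (rule costate_cong) (simp add: cut_off_def)
  have "costate T w t = mpc_costate k T w t + mat_power (transpose F) k *v costate T w (t + k)"
    unfolding eq mpc_costate_def by (rule costate_truncation) (simp add: cut_off_def)
  then show ?thesis
    using assms by (simp add: deviation_def state_mpc_input mpc_input_eq matrix_vector_right_distrib)
qed

text \<open>Eliminates the choice operator, so that integrability in \<open>w\<close> can be read
  off from the orbit and the costate.\<close>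

lemma mpc_cost_eq:
  assumes "k \<ge> 1"
  shows "mpc_cost A B Q R Qf P x0 k T w =
    (\<Sum>t<T. inner (mpc_orbit x0 k T w t) (Q *v mpc_orbit x0 k T w t)
       + inner (- (K *v mpc_orbit x0 k T w t) - L *v mpc_costate k T w t)
           (R *v (- (K *v mpc_orbit x0 k T w t) - L *v mpc_costate k T w t)))
     + inner (mpc_orbit x0 k T w T) (Qf *v mpc_orbit x0 k T w T)"
  using assms by (simp add: mpc_cost_def cost_def state_mpc_input mpc_input_eq)

lemma mpc_cost_upper_bound:
  assumes "k \<ge> 1"
  shows "mpc_cost A B Q R Qf P x0 k T w \<le> base_cost x0 T w
    + spectral_norm H * (spectral_norm L)\<^sup>2 * (spectral_norm (mat_power F k))\<^sup>2
        * (\<Sum>t<T. (norm (costate T w (t + k)))\<^sup>2)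
    + spectral_norm Qf * (norm (mpc_orbit x0 k T w T))\<^sup>2"
proof -
  define u where "u = mpc_input A B Q R P k x0 (cut_off T w)"
  define e where "e = deviation x0 T w u"
  let ?q = "\<lambda>t. (spectral_norm L)\<^sup>2 * ((spectral_norm (mat_power F k))\<^sup>2 * (norm (costate T w (t + k)))\<^sup>2)"
  have "inner (e t) (H *v e t) \<le> spectral_norm H * ?q t" if "t < T" for t
  proof -
    have e: "e t = L *v (transpose (mat_power F k) *v costate T w (t + k))"
      using deviation_mpc[OF assms that] by (simp add: e_def u_def transpose_mat_power)
    have "(norm (e t))\<^sup>2 \<le> (spectral_norm L)\<^sup>2 * (norm (transpose (mat_power F k) *v costate T w (t + k)))\<^sup>2"
      unfolding e by (rule norm_matrix_square_le)
    also have "\<dots> \<le> ?q t"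
      using norm_matrix_square_le[of "transpose (mat_power F k)"]
      by (intro mult_left_mono) (auto simp: spectral_norm_transpose)
    finally have "spectral_norm H * (norm (e t))\<^sup>2 \<le> spectral_norm H * ?q t"
      by (intro mult_left_mono spectral_norm_nonneg)
    then show ?thesis
      using inner_matrix_le_square[of "e t" H] by linarith
  qed
  then have "(\<Sum>t<T. inner (e t) (H *v e t)) \<le> (\<Sum>t<T. spectral_norm H * ?q t)"
    by (intro sum_mono) auto
  also have "\<dots> = spectral_norm H * (spectral_norm L)\<^sup>2 * (spectral_norm (mat_power F k))\<^sup>2
        * (\<Sum>t<T. (norm (costate T w (t + k)))\<^sup>2)"
    by (simp add: sum_distrib_left mult_ac)
  finally have "cost A B Q R P x0 T w u \<le> base_cost x0 T w + \<dots>"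
    by (simp add: cost_eq_base_plus_deviation e_def)
  moreover have "state A B x0 w u T = mpc_orbit x0 k T w T"
    using assms by (simp add: u_def state_mpc_input)
  ultimately show ?thesis
    using cost_terminal[of A B Q R Qf x0 T w u P] P_nonneg[of "mpc_orbit x0 k T w T"]
      inner_matrix_le_square[of "mpc_orbit x0 k T w T" Qf]
    by (simp add: mpc_cost_def flip: u_def)
qed

end

section \<open>Mean square bounds\<close>

definition L2_bounded :: "'a measure \<Rightarrow> real \<Rightarrow> ('a \<Rightarrow> real^'n) \<Rightarrow> bool" where
  "L2_bounded W D X \<longleftrightarrow> X \<in> borel_measurable W \<and> integrable W (\<lambda>w. (norm (X w))\<^sup>2) \<and>
     (\<integral>w. (norm (X w))\<^sup>2 \<partial>W) \<le> D"

lemma L2_boundedI: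
  assumes X: "X \<in> borel_measurable W" and Y: "integrable W Y" "(\<integral>w. Y w \<partial>W) \<le> D"
    and le: "\<And>w. (norm (X w))\<^sup>2 \<le> Y w"
  shows "L2_bounded W D X"
proof -
  have [measurable]: "X \<in> borel_measurable W" by (rule X)
  have "integrable W (\<lambda>w. (norm (X w))\<^sup>2)"
    using Y(1) by (rule Bochner_Integration.integrable_bound) (auto intro!: AE_I2 order_trans[OF le])
  moreover from this have "(\<integral>w. (norm (X w))\<^sup>2 \<partial>W) \<le> (\<integral>w. Y w \<partial>W)"
    using Y(1) le by (intro integral_mono) auto
  ultimately show ?thesis
    using X Y(2) by (auto simp: L2_bounded_def)
qed

lemma measurable_matrix_vector [measurable]:
  fixes M :: "real^'n^'m"
  assumes "X \<in> borel_measurable W"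
  shows "(\<lambda>w. M *v X w) \<in> borel_measurable W"
  using assms
  by (rule borel_measurable_continuous_on[OF linear_continuous_on[OF matrix_vector_mul_bounded_linear]])

lemma L2_bounded_mult:
  fixes M :: "real^'n^'m"
  assumes "L2_bounded W D X"
  shows "L2_bounded W ((spectral_norm M)\<^sup>2 * D) (\<lambda>w. M *v X w)"
  using assms
  by (intro L2_boundedI[of _ _ "\<lambda>w. (spectral_norm M)\<^sup>2 * (norm (X w))\<^sup>2"])
    (auto simp: L2_bounded_def norm_matrix_square_le intro!: mult_left_mono)

lemma L2_bounded_add:
  assumes "L2_bounded W D X" "L2_bounded W E Y"
  shows "L2_bounded W (2 * D + 2 * E) (\<lambda>w. X w + Y w)"
  using assms
  by (intro L2_boundedI[of _ _ "\<lambda>w. 2 * (norm (X w))\<^sup>2 + 2 * (norm (Y w))\<^sup>2"])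
    (auto simp: L2_bounded_def norm_add_square_le)

lemma L2_bounded_uminus: "L2_bounded W D (\<lambda>w. - X w) = L2_bounded W D X"
  by (simp add: L2_bounded_def)

lemma L2_bounded_diff:
  assumes "L2_bounded W D X" "L2_bounded W E Y"
  shows "L2_bounded W (2 * D + 2 * E) (\<lambda>w. X w - Y w)"
  using L2_bounded_add[OF assms(1), of E "\<lambda>w. - Y w"] assms(2) by (simp add: L2_bounded_uminus)

lemma (in prob_space) L2_bounded_const: "L2_bounded M ((norm x)\<^sup>2) (\<lambda>_. x)"
  by (simp add: L2_bounded_def prob_space)

text \<open>One factor \<open>1 / (1 - r)\<close> comes from Cauchy-Schwarz, the other from summing
  the weights after taking expectations. Only second moments of the single \<open>d i\<close> enter,
  so they may be correlated.\<close>

lemma L2_bounded_convolution: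
  assumes S: "exp_stable S C r" and d: "\<And>i. i < n \<Longrightarrow> L2_bounded W D (d i)" and "D \<ge> 0"
  shows "L2_bounded W (C\<^sup>2 / (1 - r)\<^sup>2 * D) (\<lambda>w. \<Sum>i<n. mat_power S i *v d i w)"
proof (rule L2_boundedI)
  have C: "C > 0" "0 < r" "r < 1"
    using S by (auto simp: exp_stable_def)
  let ?Y = "\<lambda>w. C\<^sup>2 / (1 - r) * (\<Sum>i<n. r ^ i * (norm (d i w))\<^sup>2)"
  have int: "integrable W (\<lambda>w. (norm (d i w))\<^sup>2)" if "i < n" for i
    using d[OF that] by (simp add: L2_bounded_def)
  show "(\<lambda>w. \<Sum>i<n. mat_power S i *v d i w) \<in> borel_measurable W"
    using d by (intro borel_measurable_sum measurable_matrix_vector) (auto simp: L2_bounded_def)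
  show "integrable W ?Y"
    using int by (intro integrable_mult_right Bochner_Integration.integrable_sum) auto
  have "(\<integral>w. ?Y w \<partial>W) = C\<^sup>2 / (1 - r) * (\<Sum>i<n. r ^ i * (\<integral>w. (norm (d i w))\<^sup>2 \<partial>W))"
    using int by (simp add: Bochner_Integration.integral_sum)
  also have "\<dots> \<le> C\<^sup>2 / (1 - r) * (\<Sum>i<n. r ^ i * D)"
    using C d by (intro mult_left_mono sum_mono) (auto simp: L2_bounded_def)
  also have "\<dots> = C\<^sup>2 / (1 - r) * ((\<Sum>i<n. r ^ i) * D)"
    by (simp add: sum_distrib_right)
  also have "\<dots> \<le> C\<^sup>2 / (1 - r) * (1 / (1 - r) * D)"
    using C \<open>D \<ge> 0\<close> by (intro mult_left_mono mult_right_mono geometric_sum_le) auto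
  finally show "(\<integral>w. ?Y w \<partial>W) \<le> C\<^sup>2 / (1 - r)\<^sup>2 * D"
    by (simp add: power2_eq_square)
  show "(norm (\<Sum>i<n. mat_power S i *v d i w))\<^sup>2 \<le> ?Y w" for w
    by (rule exp_stable_convolution[OF S])
qed

lemma L2_bounded_affine_orbit:
  assumes "prob_space W" and S: "exp_stable S C r"
    and d: "\<And>s. L2_bounded W D (\<lambda>w. d w s)" and "D \<ge> 0"
  shows "L2_bounded W (2 * (C * norm x0)\<^sup>2 + 2 * (C\<^sup>2 / (1 - r)\<^sup>2 * D)) (\<lambda>w. affine_orbit S x0 (d w) t)"
  unfolding affine_orbit_eq
proof (intro L2_bounded_add L2_bounded_convolution[OF S] d \<open>D \<ge> 0\<close>)
  interpret prob_space W by fact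
  have C: "C > 0" "0 < r" "r < 1" "spectral_norm (mat_power S t) \<le> C * r ^ t"
    using S by (auto simp: exp_stable_def)
  have "C * r ^ t \<le> C * 1"
    using C(1-3) by (intro mult_left_mono power_le_one) auto
  with C(4) have "spectral_norm (mat_power S t) \<le> C"
    by linarith
  then have "norm (mat_power S t *v x0) \<le> C * norm x0"
    by (intro order_trans[OF norm_matrix_le] mult_right_mono) auto
  then have "(norm (mat_power S t *v x0))\<^sup>2 \<le> (C * norm x0)\<^sup>2"
    by (rule power_mono) simp
  then show "L2_bounded W ((C * norm x0)\<^sup>2) (\<lambda>w. mat_power S t *v x0)"
    using L2_bounded_const[of "mat_power S t *v x0"] by (simp add: L2_bounded_def prob_space)
qed

lemma L2_bounded_integrable_form:
  assumes "L2_bounded W D X"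
  shows "integrable W (\<lambda>w. inner (X w) (S *v X w))"
proof (rule Bochner_Integration.integrable_bound)
  show "integrable W (\<lambda>w. spectral_norm S * (norm (X w))\<^sup>2)"
    using assms by (simp add: L2_bounded_def)
  have [measurable]: "X \<in> borel_measurable W"
    using assms by (simp add: L2_bounded_def)
  show "(\<lambda>w. inner (X w) (S *v X w)) \<in> borel_measurable W"
    by measurable
  show "AE w in W. norm (inner (X w) (S *v X w)) \<le> norm (spectral_norm S * (norm (X w))\<^sup>2)"
    using inner_matrix_le_square[of _ S] spectral_norm_nonneg[of S] by (auto simp: abs_mult)
qed

section \<open>The offline optimal cost as a random variable\<close>

lemma cost_nonneg:
  assumes "psd Q" "psd R" "psd S"
  shows "0 \<le> cost A B Q R S x0 N w u"
  using assms unfolding cost_def psd_def by (intro add_nonneg_nonneg sum_nonneg) auto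

lemma opt_cost_le:
  assumes "psd Q" "psd R" "psd Qf"
  shows "opt_cost A B Q R Qf x0 T w \<le> cost A B Q R Qf x0 T w u"
  unfolding opt_cost_def using cost_nonneg[OF assms] by (intro cINF_lower bdd_belowI2[of _ 0]) auto

lemma le_opt_cost: "(\<And>u. c \<le> cost A B Q R Qf x0 T w u) \<Longrightarrow> c \<le> opt_cost A B Q R Qf x0 T w"
  unfolding opt_cost_def by (intro cINF_greatest) auto

lemma continuous_on_matrix_vector:
  fixes M :: "real^'n^'m"
  shows "continuous_on S f \<Longrightarrow> continuous_on S (\<lambda>x. M *v f x)"
  by (rule bounded_linear.continuous_on[OF matrix_vector_mul_bounded_linear])

lemma continuous_on_state: "continuous_on UNIV (\<lambda>w. state A B x0 w u t)"
  by (induction t) (auto intro!: continuous_intros continuous_on_matrix_vector continuous_on_product_coordinates)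

lemma continuous_on_cost: "continuous_on UNIV (\<lambda>w. cost A B Q R S x0 N w u)"
  unfolding cost_def
  by (intro continuous_intros continuous_on_matrix_vector continuous_on_state)

text \<open>The infimum over uncountably many controls is measurable because it is an infimum of
  continuous functions, hence upper semicontinuous, in the product topology.\<close>

lemma opt_cost_measurable:
  fixes W :: "(nat \<Rightarrow> real^'n) measure"
  assumes "psd Q" "psd R" "psd Qf"
    and W: "sets W = sets (PiM (UNIV :: nat set) (\<lambda>t. borel :: (real^'n) measure))"
  shows "opt_cost A B Q R Qf x0 T \<in> borel_measurable W"
proof -
  \<comment> \<open>Over countably many times the product sigma-algebra is the Borel algebra of the
    product topology, so open sets of sequences are measurable.\<close>
  have W': "sets W = sets borel"
    by (simp add: W sets_PiM_equal_borel)
  have "space W = UNIV"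
    using sets_eq_imp_space_eq[OF W'] by simp
  moreover have "{w. opt_cost A B Q R Qf x0 T w < a} \<in> sets W" for a
  proof -
    have "{w. opt_cost A B Q R Qf x0 T w < a} = (\<Union>u. {w. cost A B Q R Qf x0 T w u < a})"
      unfolding opt_cost_def using cost_nonneg[OF assms(1-3)]
      by (auto simp: cINF_less_iff[OF _ bdd_belowI2[of _ 0]])
    moreover have "open {w. cost A B Q R Qf x0 T w u < a}" for u
      by (intro open_Collect_less continuous_on_cost continuous_on_const)
    ultimately show ?thesis
      unfolding W' by (auto intro!: borel_open)
  qed
  ultimately show ?thesis
    by (simp add: borel_measurable_iff_less)
qed

context lqr
begin

lemma L2_bounded_costate:
  assumes F: "exp_stable F C r" and w: "\<And>s. L2_bounded W m (\<lambda>w. v w s)" and "m \<ge> 0"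
  shows "L2_bounded W (C\<^sup>2 / (1 - r)\<^sup>2 * ((spectral_norm P)\<^sup>2 * m)) (\<lambda>w. costate N (v w) t)"
  unfolding costate_def
  using F \<open>m \<ge> 0\<close> by (intro L2_bounded_convolution L2_bounded_mult w) (auto simp: exp_stable_transpose)

text \<open>A single \<open>D\<close> is fixed before \<open>k\<close>, \<open>T\<close> and
  \<open>t\<close>; the uniformity of the final constants rests on this.\<close>

lemma L2_bounded_orbits:
  assumes W: "prob_space W" and F: "exp_stable F C r" and w: "\<And>s. L2_bounded W m (\<lambda>w. w s)" and "m \<ge> 0"
  obtains D where "D \<ge> 0" "\<And>N t. L2_bounded W D (\<lambda>w. costate N w t)"
    "\<And>k T t. L2_bounded W D (\<lambda>w. mpc_costate k T w t)"
    "\<And>T t. L2_bounded W D (\<lambda>w. offline_state x0 T w t)"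
    "\<And>k T t. L2_bounded W D (\<lambda>w. mpc_orbit x0 k T w t)"
proof -
  interpret W: prob_space W by fact
  have mono: "L2_bounded W a X \<Longrightarrow> a \<le> b \<Longrightarrow> L2_bounded W b X" for a b and X :: "_ \<Rightarrow> real^'n"
    by (auto simp: L2_bounded_def)
  define c where "c = C\<^sup>2 / (1 - r)\<^sup>2 * ((spectral_norm P)\<^sup>2 * m)"
  have cut: "L2_bounded W m (\<lambda>w. cut_off T w s)" for T s
    using w[of s] mono[OF W.L2_bounded_const[of 0] , of m] \<open>m \<ge> 0\<close> by (cases "s < T") (auto simp: cut_off_def)
  have c: "L2_bounded W c (\<lambda>w. costate N w t)" for N t
    unfolding c_def using F w \<open>m \<ge> 0\<close> by (intro L2_bounded_costate[where v = "\<lambda>w. w"]) auto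
  have c': "L2_bounded W c (\<lambda>w. mpc_costate k T w t)" for k T t
    unfolding c_def mpc_costate_def using F cut \<open>m \<ge> 0\<close> by (intro L2_bounded_costate) auto
  \<comment> \<open>Bounds the second moment of the inputs that drive both orbits, a disturbance
    minus \<open>B L\<close> applied to a costate.\<close>
  define e where "e = 2 * m + 2 * ((spectral_norm B)\<^sup>2 * ((spectral_norm L)\<^sup>2 * c))"
  have "c \<ge> 0" "e \<ge> 0"
    using \<open>m \<ge> 0\<close> by (auto simp: c_def e_def)
  define f where "f = 2 * (C * norm x0)\<^sup>2 + 2 * (C\<^sup>2 / (1 - r)\<^sup>2 * e)"
  have f: "L2_bounded W f (\<lambda>w. offline_state x0 T w t)" for T t
    unfolding f_def offline_state_def
    by (intro L2_bounded_affine_orbit[OF W F _ \<open>e \<ge> 0\<close>], unfold e_def)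
      (intro L2_bounded_diff L2_bounded_mult w c)
  have f': "L2_bounded W f (\<lambda>w. mpc_orbit x0 k T w t)" for k T t
    unfolding f_def mpc_orbit_def
    by (intro L2_bounded_affine_orbit[OF W F _ \<open>e \<ge> 0\<close>], unfold e_def)
      (intro L2_bounded_diff L2_bounded_mult cut c')
  have "f \<ge> 0"
    using \<open>e \<ge> 0\<close> by (simp add: f_def)
  with \<open>c \<ge> 0\<close> show ?thesis
    by (intro that[of "c + f"]) (auto intro: mono[OF c] mono[OF c'] mono[OF f] mono[OF f'])
qed

lemma mpc_cost_integrable:
  assumes k: "k \<ge> 1"
    and "\<And>t. L2_bounded W D (\<lambda>w. mpc_costate k T w t)" "\<And>t. L2_bounded W D (\<lambda>w. mpc_orbit x0 k T w t)"
  shows "integrable W (mpc_cost A B Q R Qf P x0 k T)"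
proof -
  have u: "L2_bounded W (2 * ((spectral_norm K)\<^sup>2 * D) + 2 * ((spectral_norm L)\<^sup>2 * D))
      (\<lambda>w. - (K *v mpc_orbit x0 k T w t) - L *v mpc_costate k T w t)" for t
    by (rule L2_bounded_diff) (simp_all only: L2_bounded_uminus L2_bounded_mult assms)
  have "integrable W (\<lambda>w. mpc_cost A B Q R Qf P x0 k T w)"
    unfolding mpc_cost_eq[OF k]
    by (intro Bochner_Integration.integrable_add Bochner_Integration.integrable_sum
      L2_bounded_integrable_form[OF assms(3)] L2_bounded_integrable_form[OF u])
  then show ?thesis by simp
qed

lemma regret_bound:
  assumes Qf: "psd Qf" and "detectable A Q" and W: "prob_space W" and F: "exp_stable F C r"
    and sets: "sets W = sets (PiM (UNIV :: nat set) (\<lambda>t. borel :: (real^'n) measure))"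
    and w: "\<And>s. L2_bounded W m (\<lambda>w. w s)" and "m \<ge> 0"
  shows "\<forall>k T. 1 \<le> k \<longrightarrow> integrable W (mpc_cost A B Q R Qf P x0 k T) \<and>
            integrable W (opt_cost A B Q R Qf x0 T)" (is ?int)
    and "\<exists>c>0. \<forall>k T. 1 \<le> k \<longrightarrow> \<bar>mpc_regret A B Q R Qf P x0 W k T\<bar>
              \<le> c * ((spectral_norm (mat_power F k))\<^sup>2 * real T + 1)"
proof -
  obtain D where D: "D \<ge> 0" "\<And>N t. L2_bounded W D (\<lambda>w. costate N w t)"
    "\<And>k T t. L2_bounded W D (\<lambda>w. mpc_costate k T w t)"
    "\<And>T t. L2_bounded W D (\<lambda>w. offline_state x0 T w t)"
    "\<And>k T t. L2_bounded W D (\<lambda>w. mpc_orbit x0 k T w t)"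
    using L2_bounded_orbits[OF W F w \<open>m \<ge> 0\<close>, of x0] by blast
  obtain E where E: "E \<ge> 0" "\<And>Qf x0 T w u. psd Qf \<Longrightarrow>
    base_cost x0 T w - E * (norm (offline_state x0 T w T))\<^sup>2 \<le> cost A B Q R Qf x0 T w u"
    using cost_lower_bound[OF assms(2)] by blast
  let ?mpc = "mpc_cost A B Q R Qf P x0" and ?opt = "opt_cost A B Q R Qf x0"
  note psd = Q posdef_imp_psd[OF R] Qf
  have opt_le: "?opt T w \<le> ?mpc k T w" for k T w
    unfolding mpc_cost_def by (rule opt_cost_le[OF psd])
  have opt_nonneg: "0 \<le> ?opt T w" for T w
    by (intro le_opt_cost cost_nonneg psd)
  have mpc_int: "integrable W (?mpc k T)" if "1 \<le> k" for k T
    using that D by (intro mpc_cost_integrable) auto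
  have opt_int: "integrable W (?opt T)" for T
  \<comment> \<open>The dominating function is the cost of MPC with a single prediction.\<close>
  proof (rule Bochner_Integration.integrable_bound[OF mpc_int[OF order_refl, of T]])
    show "AE w in W. norm (?opt T w) \<le> norm (?mpc 1 T w)"
      using opt_le[of T _ 1] opt_nonneg[of T] by (intro AE_I2) (smt (verit) real_norm_def)
  qed (rule opt_cost_measurable[OF psd sets])
  show ?int
    using mpc_int opt_int by blast
  \<comment> \<open>\<open>a\<close> is the coefficient of the term with the power of
    \<open>F\<close>; \<open>b\<close> collects the two terminal states, that of MPC and that of the
    optimum for \<open>P\<close>.\<close>
  define a b where "a = spectral_norm H * (spectral_norm L)\<^sup>2 * D" and "b = (spectral_norm Qf + E) * D"
  have ab: "a \<ge> 0" "b \<ge> 0"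
    using D(1) E(1) spectral_norm_nonneg[of H] spectral_norm_nonneg[of Qf] by (auto simp: a_def b_def)
  have "\<bar>mpc_regret A B Q R Qf P x0 W k T\<bar> \<le> (a + b + 1) * ((spectral_norm (mat_power F k))\<^sup>2 * real T + 1)"
    if k: "1 \<le> k" for k T
  proof -
    define f where "f = spectral_norm H * (spectral_norm L)\<^sup>2 * (spectral_norm (mat_power F k))\<^sup>2"
    have f: "f \<ge> 0"
      using spectral_norm_nonneg[of H] by (simp add: f_def)
    let ?Y = "\<lambda>w. f * (\<Sum>t<T. (norm (costate T w (t + k)))\<^sup>2)
      + spectral_norm Qf * (norm (mpc_orbit x0 k T w T))\<^sup>2 + E * (norm (offline_state x0 T w T))\<^sup>2"
    have int: "integrable W (\<lambda>w. (norm (costate T w t))\<^sup>2)"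
      "integrable W (\<lambda>w. (norm (mpc_orbit x0 k T w T))\<^sup>2)"
      "integrable W (\<lambda>w. (norm (offline_state x0 T w T))\<^sup>2)" for t
      using D by (auto simp: L2_bounded_def)
    \<comment> \<open>\<open>base_cost\<close> occurs in the upper bound for MPC and in the lower
      bound for the optimum, and cancels.\<close>
    have "?mpc k T w - ?opt T w \<le> ?Y w" for w
      using mpc_cost_upper_bound[OF k, of Qf x0 T w]
        le_opt_cost[OF E(2)[OF Qf], of x0 T w] by (simp add: f_def)
    then have "(\<integral>w. ?mpc k T w - ?opt T w \<partial>W) \<le> (\<integral>w. ?Y w \<partial>W)"
      using mpc_int[OF k] opt_int int
      by (intro integral_mono Bochner_Integration.integrable_add Bochner_Integration.integrable_diff
        integrable_mult_right Bochner_Integration.integrable_sum) auto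
    also have "\<dots> = f * (\<Sum>t<T. \<integral>w. (norm (costate T w (t + k)))\<^sup>2 \<partial>W)
        + spectral_norm Qf * (\<integral>w. (norm (mpc_orbit x0 k T w T))\<^sup>2 \<partial>W)
        + E * (\<integral>w. (norm (offline_state x0 T w T))\<^sup>2 \<partial>W)"
      using int by (simp add: Bochner_Integration.integral_sum)
    also have "\<dots> \<le> f * (\<Sum>t<T. D) + spectral_norm Qf * D + E * D"
      using D f E(1) by (intro add_mono mult_left_mono sum_mono spectral_norm_nonneg) (auto simp: L2_bounded_def)
    also have "\<dots> = a * ((spectral_norm (mat_power F k))\<^sup>2 * real T) + b"
      by (simp add: a_def b_def f_def algebra_simps)
    also have "\<dots> \<le> (a + b + 1) * ((spectral_norm (mat_power F k))\<^sup>2 * real T) + (a + b + 1)"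
      using ab by (intro add_mono mult_right_mono) auto
    finally have "mpc_regret A B Q R Qf P x0 W k T \<le> \<dots>"
      by (simp add: mpc_regret_def)
    moreover have "mpc_regret A B Q R Qf P x0 W k T \<ge> 0"
      unfolding mpc_regret_def by (intro Bochner_Integration.integral_nonneg) (simp add: opt_le)
    ultimately show ?thesis
      by (simp add: algebra_simps)
  qed
  then show "\<exists>c>0. \<forall>k T. 1 \<le> k \<longrightarrow> \<bar>mpc_regret A B Q R Qf P x0 W k T\<bar>
              \<le> c * ((spectral_norm (mat_power F k))\<^sup>2 * real T + 1)"
    using ab by (intro exI[of _ "a + b + 1"]) auto
qed

end

theorem theorem4p6:
  fixes A Q Qf P F :: "real^'n^'n" and B :: "real^'d^'n" and R :: "real^'d^'d"
    and x0 :: "real^'n" and W :: "(nat \<Rightarrow> real^'n) measure" and m lam :: real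
  assumes "psd Q" and "psd Qf" and "posdef R"
    and "stabilizable A B" and "detectable A Q"
    and "psd P" and "riccati_solution A B Q R P"
    and F: "F = closed_loop A B R P"
    and lam: "lam = (1 + spec_radius F) / 2"
    and "prob_space W"
    and "sets W = sets (PiM (UNIV :: nat set) (\<lambda>t. borel :: (real^'n) measure))"
    and "m > 0"
    and "\<And>t t'. integrable W (\<lambda>w. inner (w t) (w t'))"
    and "\<And>t t'. (\<integral>w. inner (w t) (w t') \<partial>W) \<le> m"
  shows "(\<forall>k T. 1 \<le> k \<and> k \<le> T \<longrightarrow>
            integrable W (mpc_cost A B Q R Qf P x0 k T) \<and>
            integrable W (opt_cost A B Q R Qf x0 T) \<and>
            mpc_regret A B Q R Qf P x0 W k T
              = MPCS A B Q R Qf P x0 W k T - STO A B Q R Qf x0 W T) \<and>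
         (\<exists>C>0. \<forall>k T. 1 \<le> k \<and> k \<le> T \<longrightarrow>
            \<bar>mpc_regret A B Q R Qf P x0 W k T\<bar>
              \<le> C * ((spectral_norm (mat_power F k))\<^sup>2 * real T + 1)) \<and>
         (\<exists>C>0. \<forall>k T. 1 \<le> k \<and> k \<le> T \<longrightarrow>
            (spectral_norm (mat_power F k))\<^sup>2 * real T + 1
              \<le> C * (lam ^ (2 * k) * real T + 1)) \<and>
         (\<exists>C>0. \<forall>k T. 1 \<le> k \<and> k \<le> T \<longrightarrow>
            \<bar>mpc_regret A B Q R Qf P x0 W k T\<bar>
              \<le> C * (lam ^ (2 * k) * real T + 1))"
proof -
  interpret lqr A Q P B R
    using assms by unfold_locales auto
  have F_eq: "lqr.F A P B R = F"
    using F by (simp add: F_def)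
  \<comment> \<open>As \<open>lam\<close> is the midpoint of \<open>spec_radius F\<close> and 1,
    both inequalities amount to \<open>spec_radius F < 1\<close>.\<close>
  have "spec_radius F < lam" "lam < 1"
    using spec_radius_F[OF \<open>detectable A Q\<close>] by (simp_all add: F_eq lam)
  then obtain C where C: "exp_stable F C lam"
    using spec_radius_imp_exp_stable by blast
  \<comment> \<open>The diagonal case \<open>t = t'\<close> of the moment assumptions is the second
    moment of \<open>w s\<close>.\<close>
  have w: "L2_bounded W m (\<lambda>w. w s)" for s
  proof -
    have "(\<lambda>w. w s) \<in> borel_measurable W"
      using measurable_component_singleton[of s UNIV "\<lambda>_. borel :: (real^'n) measure"]
      by (subst measurable_cong_sets[OF assms(11) refl]) auto
    then show ?thesis
      using assms(13)[of s s] assms(14)[of s s] by (simp add: L2_bounded_def power2_norm_eq_inner)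
  qed
  have "m \<ge> 0"
    using \<open>m > 0\<close> by simp
  note bound = regret_bound[OF \<open>psd Qf\<close> \<open>detectable A Q\<close> \<open>prob_space W\<close> _ assms(11) w \<open>m \<ge> 0\<close>,
    unfolded F_eq, OF C, of x0]
  have int: "integrable W (mpc_cost A B Q R Qf P x0 k T)" "integrable W (opt_cost A B Q R Qf x0 T)"
    if "1 \<le> k" for k T
    using bound(1) that by blast+
  then have regret_eq: "mpc_regret A B Q R Qf P x0 W k T = MPCS A B Q R Qf P x0 W k T - STO A B Q R Qf x0 W T"
    if "1 \<le> k" for k T
    using that by (simp add: mpc_regret_def MPCS_def STO_def)
  obtain c1 where c1: "c1 > 0" "\<And>k T. 1 \<le> k \<Longrightarrow> \<bar>mpc_regret A B Q R Qf P x0 W k T\<bar>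
      \<le> c1 * ((spectral_norm (mat_power F k))\<^sup>2 * real T + 1)"
    using bound(2) by blast
  \<comment> \<open>The square of \<open>C\<close> absorbs the decay constant of \<open>F\<close>,
    and the summand 1 covers the term that does not grow with \<open>T\<close>.\<close>
  define c2 where "c2 = C\<^sup>2 + 1"
  have c2: "(spectral_norm (mat_power F k))\<^sup>2 * real T + 1 \<le> c2 * (lam ^ (2 * k) * real T + 1)" for k T
  proof -
    have "(spectral_norm (mat_power F k))\<^sup>2 \<le> (C * lam ^ k)\<^sup>2"
      using C by (intro power_mono spectral_norm_nonneg) (auto simp: exp_stable_def)
    also have "\<dots> = C\<^sup>2 * lam ^ (2 * k)"
      by (simp add: power_mult_distrib power_even_eq)
    also have "\<dots> \<le> c2 * lam ^ (2 * k)"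
      using C by (intro mult_right_mono) (auto simp: exp_stable_def c2_def)
    finally have "(spectral_norm (mat_power F k))\<^sup>2 * real T + 1 \<le> (c2 * lam ^ (2 * k)) * real T + c2"
      by (intro add_mono mult_right_mono) (auto simp: c2_def)
    then show ?thesis
      by (simp add: algebra_simps)
  qed
  have "c2 > 0"
    by (simp add: c2_def add_nonneg_pos)
  have c12: "\<bar>mpc_regret A B Q R Qf P x0 W k T\<bar> \<le> (c1 * c2) * (lam ^ (2 * k) * real T + 1)"
    if "1 \<le> k" for k T
    using order_trans[OF c1(2)[OF that] mult_left_mono[OF c2 less_imp_le[OF c1(1)]]]
    by (simp only: mult.assoc)
  have "c1 * c2 > 0"
    using c1(1) \<open>c2 > 0\<close> by simp
  show ?thesis
  proof (intro conjI exI allI impI)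
    fix k T :: nat assume "1 \<le> k \<and> k \<le> T"
    then have k: "1 \<le> k" ..
    show "integrable W (mpc_cost A B Q R Qf P x0 k T)" "integrable W (opt_cost A B Q R Qf x0 T)"
      "mpc_regret A B Q R Qf P x0 W k T = MPCS A B Q R Qf P x0 W k T - STO A B Q R Qf x0 W T"
      "\<bar>mpc_regret A B Q R Qf P x0 W k T\<bar> \<le> c1 * ((spectral_norm (mat_power F k))\<^sup>2 * real T + 1)"
      "(spectral_norm (mat_power F k))\<^sup>2 * real T + 1 \<le> c2 * (lam ^ (2 * k) * real T + 1)"
      "\<bar>mpc_regret A B Q R Qf P x0 W k T\<bar> \<le> (c1 * c2) * (lam ^ (2 * k) * real T + 1)"
      by (fact int[OF k] regret_eq[OF k] c1(2)[OF k] c2 c12[OF k])+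
  qed fact+
qed

end
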